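(* Let $k\ge 1$ and let $g:\mathbb{R}_+^k\to\mathbb{R}$ be a generalized Hermite kernel with homogeneity exponent $\alpha\in(-\frac{k+1}{2},-\frac{k}{2})$. Then for every $t>0$ the function $$h_t(\mathbf{x})=\int_0^t g(s\mathbf{1}-\mathbf{x})\,1_{\{s\mathbf{1}>\mathbf{x}\}}\,ds,\qquad \mathbf{x}\in\mathbb{R}^k,$$ is well-defined as an element of $L^2(\mathbb{R}^k)$, and the process defined by $Z(t):=I_k(h_t)$ is an $H$-sssi process with $$H=\alpha+\frac{k}{2}+1\in(1/2,1).$$
   Context: Notation: $\mathbb{R}_+=(0,\infty)$, $\mathbf{1}=(1,\ldots,1)$; $\mathbf{x}>\mathbf{y}$ means $x_j>y_j$ for all $j$. A generalized Hermite kernel of order $k$ is a nonzero measurable function $g:\mathbb{R}_+^k\to\mathbb{R}$ such that (A) $g(\lambda\mathbf{x})=\lambda^\alpha g(\mathbf{x})$ for all $\lambda>0$, where $\alpha\in(-\frac{k+1}{2},-\frac{k}{2})$ (the homogeneity exponent); (B) $\int_{\mathbb{R}_+^k}|g(\mathbf{x})g(\mathbf{1}+\mathbf{x})|\,d\mathbf{x}<\infty$. For $f\in L^2(\mathbb{R}^k)$, $I_k(f)=\int'_{\mathbb{R}^k}f(x_1,\ldots,x_k)W(dx_1)\cdots W(dx_k)$ is the $k$-tuple Wiener-Itô integral with respect to Brownian motion $W$ on $\mathbb{R}$ (the diagonals $x_p=x_q$, $p\ne q$, are excluded). One sets $h_0=0$. A real-valued finite-variance process $\{X(t),t\ge0\}$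 is $H$-sssi if (self-similarity) for every $a>0$, $\{X(at)\}_{t\ge 0}$ and $\{a^HX(t)\}_{t\ge 0}$ have the same finite-dimensional distributions, and (stationary increments) for every $h\ge0$ the process $\{X(t+h)-X(t),t\ge0\}$ is stationary. *)

theory Defs
  imports "HOL-Probability.Probability"
begin

section \<open>Square-integrable functions\<close>

definition square_integrable :: "'a measure \<Rightarrow> ('a \<Rightarrow> real) \<Rightarrow> bool" where
  "square_integrable M f \<longleftrightarrow> f \<in> borel_measurable M \<and> integrable M (\<lambda>x. (f x)\<^sup>2)"

definition tendsto_L2 :: "'a measure \<Rightarrow> (nat \<Rightarrow> 'a \<Rightarrow> real) \<Rightarrow> ('a \<Rightarrow> real) \<Rightarrow> bool" where
  "tendsto_L2 M F f \<longleftrightarrow> (\<lambda>n. \<integral>\<^sup>+x. ennreal ((F n x - f x)\<^sup>2) \<partial>M) \<longlonglongrightarrow> 0"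

section \<open>Processes\<close>

text \<open>Here \<open>T\<close> is the time set: the processes \<open>(X t)\<close> and \<open>(Y t)\<close>, \<open>t \<in> T\<close>, are compared, and their
  values at other times are irrelevant.\<close>

definition same_fdd :: "'a measure \<Rightarrow> real set \<Rightarrow> (real \<Rightarrow> 'a \<Rightarrow> real) \<Rightarrow> (real \<Rightarrow> 'a \<Rightarrow> real) \<Rightarrow> bool" where
  "same_fdd M T X Y \<longleftrightarrow>
     (\<forall>J. finite J \<and> J \<subseteq> T \<longrightarrow>
        distr M (Pi\<^sub>M J (\<lambda>_. borel)) (\<lambda>\<omega>. \<lambda>t\<in>J. X t \<omega>) =
        distr M (Pi\<^sub>M J (\<lambda>_. borel)) (\<lambda>\<omega>. \<lambda>t\<in>J. Y t \<omega>))"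

definition stationary :: "'a measure \<Rightarrow> (real \<Rightarrow> 'a \<Rightarrow> real) \<Rightarrow> bool" where
  "stationary M X \<longleftrightarrow> (\<forall>s\<ge>0. same_fdd M {0..} (\<lambda>t. X (t + s)) X)"

definition self_similar :: "'a measure \<Rightarrow> real \<Rightarrow> (real \<Rightarrow> 'a \<Rightarrow> real) \<Rightarrow> bool" where
  "self_similar M H X \<longleftrightarrow>
     (\<forall>a>0. same_fdd M {0..} (\<lambda>t. X (a * t)) (\<lambda>t \<omega>. a powr H * X t \<omega>))"

definition stationary_increments :: "'a measure \<Rightarrow> (real \<Rightarrow> 'a \<Rightarrow> real) \<Rightarrow> bool" where
  "stationary_increments M X \<longleftrightarrow> (\<forall>h\<ge>0. stationary M (\<lambda>t \<omega>. X (t + h) \<omega> - X t \<omega>))"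

definition sssi :: "'a measure \<Rightarrow> real \<Rightarrow> (real \<Rightarrow> 'a \<Rightarrow> real) \<Rightarrow> bool" where
  "sssi M H X \<longleftrightarrow>
     (\<forall>t\<ge>0. square_integrable M (X t)) \<and> self_similar M H X \<and> stationary_increments M X"

section \<open>Brownian motion on the real line\<close>

definition brownian_motion :: "'a measure \<Rightarrow> (real \<Rightarrow> 'a \<Rightarrow> real) \<Rightarrow> bool" where
  "brownian_motion M W \<longleftrightarrow>
     prob_space M \<and>
     (\<forall>t. W t \<in> borel_measurable M) \<and>
     (AE \<omega> in M. W 0 \<omega> = 0) \<and>
     (AE \<omega> in M. continuous_on UNIV (\<lambda>t. W t \<omega>)) \<and>
     (\<forall>t n. strict_mono t \<longrightarrow>
        prob_space.indep_vars M (\<lambda>_. borel) (\<lambda>i \<omega>. W (t (Suc i)) \<omega> - W (t i) \<omega>) {..<n::nat}) \<and>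
     (\<forall>s t. s < t \<longrightarrow>
        distributed M lborel (\<lambda>\<omega>. W t \<omega> - W s \<omega>) (normal_density 0 (sqrt (t - s))))"

section \<open>Multiple Wiener-Ito integrals\<close>

text \<open>A step function over the grid \<open>t 0 < \<dots> < t n\<close> has the value \<open>c j\<close> on the cell
  \<open>\<Prod>i. (t (j i), t (j i + 1)]\<close>. Only cells with injective multi-index \<open>j\<close> occur, so that the
  function vanishes whenever two coordinates lie in the same grid interval.\<close>

definition off_diagonal_indices :: "nat \<Rightarrow> ('k::finite \<Rightarrow> nat) set" where
  "off_diagonal_indices n = {j. inj j \<and> (\<forall>i. j i < n)}"

definition step_function ::
    "(nat \<Rightarrow> real) \<Rightarrow> nat \<Rightarrow> (('k::finite \<Rightarrow> nat) \<Rightarrow> real) \<Rightarrow> real ^ 'k \<Rightarrow> real" where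
  "step_function t n c x =
     (\<Sum>j\<in>off_diagonal_indices n. c j * (\<Prod>i\<in>UNIV. indicator {t (j i)<..t (Suc (j i))} (x $ i)))"

definition step_integral ::
    "(real \<Rightarrow> 'a \<Rightarrow> real) \<Rightarrow> (nat \<Rightarrow> real) \<Rightarrow> nat \<Rightarrow> (('k::finite \<Rightarrow> nat) \<Rightarrow> real) \<Rightarrow> 'a \<Rightarrow> real" where
  "step_integral W t n c \<omega> =
     (\<Sum>j\<in>off_diagonal_indices n. c j * (\<Prod>i\<in>UNIV. W (t (Suc (j i))) \<omega> - W (t (j i)) \<omega>))"

text \<open>The integral of a square-integrable function is the \<open>L\<^sup>2\<close>-limit of the integrals of
  approximating step functions. It is determined up to almost sure equality only.\<close>

definition has_wiener_ito_integral ::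
    "'a measure \<Rightarrow> (real \<Rightarrow> 'a \<Rightarrow> real) \<Rightarrow> (real ^ 'k::finite \<Rightarrow> real) \<Rightarrow> ('a \<Rightarrow> real) \<Rightarrow> bool" where
  "has_wiener_ito_integral M W f Y \<longleftrightarrow>
     square_integrable lebesgue f \<and> square_integrable M Y \<and>
     (\<exists>t n c. (\<forall>m. strict_mono (t m)) \<and>
        tendsto_L2 lebesgue (\<lambda>m. step_function (t m) (n m) (c m)) f \<and>
        tendsto_L2 M (\<lambda>m. step_integral W (t m) (n m) (c m)) Y)"

definition wiener_ito_integral ::
    "'a measure \<Rightarrow> (real \<Rightarrow> 'a \<Rightarrow> real) \<Rightarrow> (real ^ 'k::finite \<Rightarrow> real) \<Rightarrow> 'a \<Rightarrow> real" where
  "wiener_ito_integral M W f = (SOME Y. has_wiener_ito_integral M W f Y)"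

section \<open>Generalized Hermite kernels\<close>

definition pos_orthant :: "(real ^ 'k::finite) set" where
  "pos_orthant = {x. \<forall>i. 0 < x $ i}"

text \<open>A kernel is a total function here, but only its values on the positive orthant matter. The
  order is \<open>CARD('k)\<close>, and \<open>1 :: real ^ 'k\<close> is the vector all of whose coordinates are 1.\<close>

definition generalized_Hermite_kernel :: "real \<Rightarrow> (real ^ 'k::finite \<Rightarrow> real) \<Rightarrow> bool" where
  "generalized_Hermite_kernel \<alpha> g \<longleftrightarrow>
     g \<in> borel_measurable (lebesgue_on pos_orthant) \<and>
     (\<exists>x\<in>pos_orthant. g x \<noteq> 0) \<and>
     - (real CARD('k) + 1) / 2 < \<alpha> \<and> \<alpha> < - real CARD('k) / 2 \<and>
     (\<forall>l>0. \<forall>x\<in>pos_orthant. g (l *\<^sub>R x) = l powr \<alpha> * g x) \<and>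
     (\<integral>\<^sup>+x\<in>pos_orthant. ennreal \<bar>g x * g (1 + x)\<bar> \<partial>lebesgue) < \<infinity>"

definition h_integrand :: "(real ^ 'k::finite \<Rightarrow> real) \<Rightarrow> real ^ 'k \<Rightarrow> real \<Rightarrow> real" where
  "h_integrand g x s = (if \<forall>i. s > x $ i then g (s *\<^sub>R 1 - x) else 0)"

text \<open>For \<open>t = 0\<close> this is the zero function.\<close>

definition h_fun :: "(real ^ 'k::finite \<Rightarrow> real) \<Rightarrow> real \<Rightarrow> real ^ 'k \<Rightarrow> real" where
  "h_fun g t x = (LINT s:{0..t}|lebesgue. h_integrand g x s)"

end

(* Over a common grid, the Wiener-Ito integrals of step functions are polynomials in the independent
   Gaussian increments, and E I(f)^2 is at most k^k times the squared norm of f. Off-diagonal step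
   functions are dense in L2, so the integral exists and depends, up to a null set, only on the
   L2-class of its integrand. The increments of r -> W (a r + b) are distributed like those of
   sqrt a W; passing to L2-limits, the integrals of x -> d f ((x - b 1) / a) are jointly distributed
   like d a^(k/2) times the integrals of f. Homogeneity of g gives h_{at}(a x) = a^(1 + alpha) h_t(x),
   and h_{v+b} - h_{u+b} is the translate of h_v - h_u by b 1, whence self-similarity with
   H = alpha + k/2 + 1 and stationarity of the increments.

   h_t is in L2 because, by Tonelli and scaling, its squared norm is at most the double integral over
   [0,t]^2 of |s - s'|^(2 alpha + k) times the constant in condition (B), and 2 alpha + k > -1. *)
theory Submission
  imports Defs
begin

section \<open>Square-integrable functions and their limits\<close>

text \<open>The integrand need not be symmetric, so there is no isometry to exploit: an upper bound
  on E I(f)^2 with some constant depending on k alone is all that existence and uniqueness of the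
  integral require. Since the integral is picked by a choice operator and determined only up to a
  null set, distributional statements go through approximating sequences, which the bound makes
  interchangeable. Laws survive mean-square limits because they are tested with products of
  Lipschitz functions.

  Lebesgue measurability obstructs the construction of h_t: (x, s) -> g(s 1 - x) need not be
  measurable for the product sigma-algebra, so the Tonelli argument runs on a Borel version of the
  kernel, and the identities for h_t are proved at points x where the time integral converges, that
  is, almost everywhere. The singularity |s - s'|^(2 alpha + k) is integrable exactly when alpha >
  -(k+1)/2, which is also the condition H > 1/2; alpha < -k/2 is the condition H < 1.\<close>

abbreviation L2_sqdist :: "'a measure \<Rightarrow> ('a \<Rightarrow> real) \<Rightarrow> ('a \<Rightarrow> real) \<Rightarrow> ennreal" where
  "L2_sqdist M f g \<equiv> \<integral>\<^sup>+x. ennreal ((f x - g x)\<^sup>2) \<partial>M"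

lemma square_integrable_iff_nn_integral:
  "square_integrable M f \<longleftrightarrow> f \<in> borel_measurable M \<and> (\<integral>\<^sup>+x. ennreal ((f x)\<^sup>2) \<partial>M) < \<infinity>"
  unfolding square_integrable_def by (auto simp: integrable_iff_bounded)

lemma square_integrable_measurable [dest]:
  "square_integrable M f \<Longrightarrow> f \<in> borel_measurable M"
  by (simp add: square_integrable_def)

lemma L2_sqdist_commute: "L2_sqdist M f g = L2_sqdist M g f"
  by (simp add: power2_commute)

lemma L2_sqdist_triangle:
  assumes [measurable]: "f \<in> borel_measurable M" "g \<in> borel_measurable M" "h \<in> borel_measurable M"
  shows "L2_sqdist M f h \<le> 2 * L2_sqdist M f g + 2 * L2_sqdist M g h"
proof -
  have pw: "(a - c)\<^sup>2 \<le> 2 * (a - b)\<^sup>2 + 2 * (b - c)\<^sup>2" for a b c :: real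
  proof -
    \<comment> \<open>The difference of the two sides is exactly this square.\<close>
    have "0 \<le> (a - 2 * b + c)\<^sup>2" by simp
    then show ?thesis by (simp add: power2_eq_square algebra_simps)
  qed
  have "ennreal ((f x - h x)\<^sup>2) \<le> 2 * ennreal ((f x - g x)\<^sup>2) + 2 * ennreal ((g x - h x)\<^sup>2)" for x
  proof -
    have "ennreal ((f x - h x)\<^sup>2) \<le> ennreal (2 * (f x - g x)\<^sup>2 + 2 * (g x - h x)\<^sup>2)"
      by (intro ennreal_leI pw)
    also have "\<dots> = 2 * ennreal ((f x - g x)\<^sup>2) + 2 * ennreal ((g x - h x)\<^sup>2)"
      by (simp add: ennreal_mult)
    finally show ?thesis .
  qed
  then have "L2_sqdist M f h \<le>
      (\<integral>\<^sup>+x. 2 * ennreal ((f x - g x)\<^sup>2) + 2 * ennreal ((g x - h x)\<^sup>2) \<partial>M)"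
    by (intro nn_integral_mono)
  also have "\<dots> = 2 * L2_sqdist M f g + 2 * L2_sqdist M g h"
    by (subst nn_integral_add) (auto simp: nn_integral_cmult)
  finally show ?thesis .
qed

lemma square_integrable_diff:
  assumes "square_integrable M f" "square_integrable M g"
  shows "square_integrable M (\<lambda>x. f x - g x)"
proof -
  have [measurable]: "f \<in> borel_measurable M" "g \<in> borel_measurable M"
    using assms by auto
  have "L2_sqdist M f g \<le> 2 * L2_sqdist M f (\<lambda>_. 0) + 2 * L2_sqdist M (\<lambda>_. 0) g"
    by (rule L2_sqdist_triangle) auto
  also have "\<dots> < \<infinity>"
    using assms by (auto simp: square_integrable_iff_nn_integral ennreal_mult_less_top)
  finally show ?thesis
    by (simp add: square_integrable_iff_nn_integral)
qed

lemma tendsto_L2_cmult: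
  assumes "tendsto_L2 M F f" "\<And>n. F n \<in> borel_measurable M" "f \<in> borel_measurable M"
  shows "tendsto_L2 M (\<lambda>n x. c * F n x) (\<lambda>x. c * f x)"
proof -
  have "L2_sqdist M (\<lambda>x. c * F n x) (\<lambda>x. c * f x) = ennreal (c\<^sup>2) * L2_sqdist M (F n) f" for n
    using assms(2,3)
    by (subst nn_integral_cmult [symmetric])
       (auto simp: ennreal_mult [symmetric] power_mult_distrib [symmetric] right_diff_distrib)
  moreover have "(\<lambda>n. ennreal (c\<^sup>2) * L2_sqdist M (F n) f) \<longlonglongrightarrow> ennreal (c\<^sup>2) * 0"
    using assms(1) unfolding tendsto_L2_def by (intro ennreal_tendsto_cmult) auto
  ultimately show ?thesis
    unfolding tendsto_L2_def by simp
qed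

lemma tendsto_L2_trans:
  assumes "tendsto_L2 M F f" "(\<lambda>n. L2_sqdist M (G n) (F n)) \<longlonglongrightarrow> 0"
    and [measurable]: "\<And>n. F n \<in> borel_measurable M" "\<And>n. G n \<in> borel_measurable M"
      "f \<in> borel_measurable M"
  shows "tendsto_L2 M G f"
  unfolding tendsto_L2_def
proof (rule tendsto_sandwich [OF _ _ tendsto_const])
  have "(\<lambda>n. 2 * L2_sqdist M (G n) (F n) + 2 * L2_sqdist M (F n) f) \<longlonglongrightarrow> 2 * 0 + 2 * 0"
    using assms(1,2) unfolding tendsto_L2_def
    by (intro tendsto_add ennreal_tendsto_cmult) auto
  then show "(\<lambda>n. 2 * L2_sqdist M (G n) (F n) + 2 * L2_sqdist M (F n) f) \<longlonglongrightarrow> 0"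
    by simp
  show "\<forall>\<^sub>F n in sequentially. L2_sqdist M (G n) f \<le> 2 * L2_sqdist M (G n) (F n) + 2 * L2_sqdist M (F n) f"
    by (intro always_eventually allI L2_sqdist_triangle) auto
qed auto

lemma tendsto_L2_diff:
  assumes "tendsto_L2 M F f" "tendsto_L2 M G g"
    and [measurable]: "\<And>n. F n \<in> borel_measurable M" "\<And>n. G n \<in> borel_measurable M"
      "f \<in> borel_measurable M" "g \<in> borel_measurable M"
  shows "tendsto_L2 M (\<lambda>n x. F n x - G n x) (\<lambda>x. f x - g x)"
proof (rule tendsto_L2_trans [where F = "\<lambda>n x. f x - G n x"])
  show "tendsto_L2 M (\<lambda>n x. f x - G n x) (\<lambda>x. f x - g x)"
    using assms(2) unfolding tendsto_L2_def
    by (simp add: power2_commute)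
  show "(\<lambda>n. L2_sqdist M (\<lambda>x. F n x - G n x) (\<lambda>x. f x - G n x)) \<longlonglongrightarrow> 0"
    using assms(1) unfolding tendsto_L2_def by simp
qed auto

lemma tendsto_L2_dominated:
  assumes [measurable]: "\<And>n. F n \<in> borel_measurable M" "f \<in> borel_measurable M"
    and w: "square_integrable M w"
    and bound: "\<And>n. AE x in M. \<bar>F n x\<bar> \<le> \<bar>w x\<bar>" "AE x in M. \<bar>f x\<bar> \<le> \<bar>w x\<bar>"
    and lim: "AE x in M. (\<lambda>n. F n x) \<longlonglongrightarrow> f x"
  shows "tendsto_L2 M F f"
proof -
  have [measurable]: "w \<in> borel_measurable M" using w by auto
  have "(\<lambda>n. L2_sqdist M (F n) f) \<longlonglongrightarrow> (\<integral>\<^sup>+x. 0 \<partial>M)"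
  proof (rule nn_integral_dominated_convergence [where w = "\<lambda>x. 4 * ennreal ((w x)\<^sup>2)"])
    show "AE x in M. ennreal ((F n x - f x)\<^sup>2) \<le> 4 * ennreal ((w x)\<^sup>2)" for n
      using bound(1)[of n] bound(2)
    proof eventually_elim
      fix x assume "\<bar>F n x\<bar> \<le> \<bar>w x\<bar>" "\<bar>f x\<bar> \<le> \<bar>w x\<bar>"
      then have "(F n x - f x)\<^sup>2 \<le> (2 * w x)\<^sup>2"
        by (intro abs_le_square_iff [THEN iffD1]) (auto simp: abs_mult)
      then show "ennreal ((F n x - f x)\<^sup>2) \<le> 4 * ennreal ((w x)\<^sup>2)"
        by (simp add: ennreal_mult [symmetric] power_mult_distrib ennreal_leI
            flip: ennreal_numeral)
    qed
    show "(\<integral>\<^sup>+x. 4 * ennreal ((w x)\<^sup>2) \<partial>M) < \<infinity>"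
      using w by (auto simp: square_integrable_iff_nn_integral nn_integral_cmult ennreal_mult_less_top)
    show "AE x in M. (\<lambda>n. ennreal ((F n x - f x)\<^sup>2)) \<longlonglongrightarrow> 0"
      using lim
    proof eventually_elim
      fix x assume "(\<lambda>n. F n x) \<longlonglongrightarrow> f x"
      then have "(\<lambda>n. (F n x - f x)\<^sup>2) \<longlonglongrightarrow> (f x - f x)\<^sup>2"
        by (intro tendsto_intros)
      then show "(\<lambda>n. ennreal ((F n x - f x)\<^sup>2)) \<longlonglongrightarrow> 0"
        using tendsto_ennrealI by fastforce
    qed
  qed auto
  then show ?thesis
    by (simp add: tendsto_L2_def)
qed

section \<open>Completeness of L2\<close>

lemma fast_L2_Cauchy_AE_convergent:
  assumes [measurable]: "\<And>n. F n \<in> borel_measurable M"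
    and fast: "\<And>n. L2_sqdist M (F (Suc n)) (F n) \<le> ennreal ((1/8) ^ n)"
  shows "AE x in M. convergent (\<lambda>n. F n x)"
proof -
  \<comment> \<open>The weight \<open>4 ^ n\<close> meets two needs:
    \<open>4 ^ n * (1/8) ^ n\<close> is still summable, and its square root \<open>2 ^ n\<close>
    forces the increments of \<open>F n x\<close> to decay geometrically wherever the weighted
    series is finite.\<close>
  have "(\<integral>\<^sup>+x. (\<Sum>n. ennreal (4 ^ n) * ennreal ((F (Suc n) x - F n x)\<^sup>2)) \<partial>M) =
      (\<Sum>n. ennreal (4 ^ n) * L2_sqdist M (F (Suc n)) (F n))"
    by (subst nn_integral_suminf) (auto simp: nn_integral_cmult)
  also have "\<dots> \<le> (\<Sum>n. ennreal ((1/2) ^ n))"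
  proof (intro suminf_le summableI)
    fix n
    have "ennreal (4 ^ n) * L2_sqdist M (F (Suc n)) (F n) \<le> ennreal (4 ^ n) * ennreal ((1/8) ^ n)"
      by (intro mult_left_mono fast) auto
    also have "\<dots> = ennreal ((1/2) ^ n)"
      by (simp add: ennreal_mult [symmetric] power_mult_distrib [symmetric])
    finally show "ennreal (4 ^ n) * L2_sqdist M (F (Suc n)) (F n) \<le> ennreal ((1/2) ^ n)" .
  qed
  also have "\<dots> < \<infinity>"
    by (simp only: infinity_ennreal_def top.not_eq_extremum [symmetric],
        rule ennreal_suminf_neq_top) (auto simp: summable_geometric)
  finally have "AE x in M. (\<Sum>n. ennreal (4 ^ n) * ennreal ((F (Suc n) x - F n x)\<^sup>2)) \<noteq> \<infinity>"
    by (intro nn_integral_PInf_AE) auto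
  then show ?thesis
  proof eventually_elim
    fix x assume fin: "(\<Sum>n. ennreal (4 ^ n) * ennreal ((F (Suc n) x - F n x)\<^sup>2)) \<noteq> \<infinity>"
    define C where "C = enn2real (\<Sum>n. ennreal (4 ^ n) * ennreal ((F (Suc n) x - F n x)\<^sup>2))"
    have C: "(\<Sum>n. ennreal (4 ^ n) * ennreal ((F (Suc n) x - F n x)\<^sup>2)) = ennreal C" "C \<ge> 0"
      using fin by (auto simp: C_def top.not_eq_extremum)
    have bd: "\<bar>F (Suc n) x - F n x\<bar> \<le> sqrt C * (1/2) ^ n" for n
    proof -
      have "ennreal (4 ^ n) * ennreal ((F (Suc n) x - F n x)\<^sup>2) \<le> ennreal C"
        unfolding C(1) [symmetric] using sum_le_suminf [of "\<lambda>n. ennreal (4 ^ n) * ennreal ((F (Suc n) x - F n x)\<^sup>2)" "{n}"]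
        by (auto intro: summableI)
      then have "4 ^ n * (F (Suc n) x - F n x)\<^sup>2 \<le> C"
        using C(2) by (simp add: ennreal_mult [symmetric])
      then have "(2 ^ n * \<bar>F (Suc n) x - F n x\<bar>)\<^sup>2 \<le> C"
      proof -
        have "(2 ^ n)\<^sup>2 = (4 :: real) ^ n"
          using power_mult [of "2 :: real" n 2] power_mult [of "2 :: real" 2 n]
          by (simp add: mult.commute)
        with \<open>4 ^ n * (F (Suc n) x - F n x)\<^sup>2 \<le> C\<close> show ?thesis
          by (simp add: power_mult_distrib)
      qed
      then have "2 ^ n * \<bar>F (Suc n) x - F n x\<bar> \<le> sqrt C"
        by (rule real_le_rsqrt)
      then show ?thesis
        by (simp add: field_simps power_one_over)
    qed
    have "summable (\<lambda>n. F (Suc n) x - F n x)"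
      by (rule summable_comparison_test' [where N = 0 and g = "\<lambda>n. sqrt C * (1/2) ^ n"])
         (use bd in \<open>auto intro!: summable_mult simp: summable_geometric\<close>)
    then have "convergent (\<lambda>n. (F n x - F 0 x) + F 0 x)"
      by (intro convergent_add convergent_const)
         (simp add: summable_iff_convergent sum_lessThan_telescope [where f = "\<lambda>n. F n x"])
    then show "convergent (\<lambda>n. F n x)" by simp
  qed
qed

text \<open>Riesz-Fischer: a subsequence with gaps \<open>(1/8) ^ i\<close> converges almost
  everywhere, and Fatou's lemma carries the Cauchy bound over to its limit.\<close>

theorem L2_complete:
  assumes sq: "\<And>n. square_integrable M (F n)"
    and Cauchy: "\<And>e. e > 0 \<Longrightarrow> \<exists>N. \<forall>m\<ge>N. \<forall>n\<ge>N. L2_sqdist M (F m) (F n) \<le> ennreal e"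
  obtains f where "square_integrable M f" "tendsto_L2 M F f"
proof -
  have [measurable]: "F n \<in> borel_measurable M" for n using sq by auto
  obtain N where N: "\<And>i m n. m \<ge> N i \<Longrightarrow> n \<ge> N i \<Longrightarrow> L2_sqdist M (F m) (F n) \<le> ennreal ((1/8) ^ i)"
    using Cauchy [of "(1/8) ^ i" for i] by simp metis
  \<comment> \<open>Adding up the thresholds makes \<open>r\<close> monotone, so that both
    \<open>r i\<close> and \<open>r (Suc i)\<close> lie beyond \<open>N i\<close>.\<close>
  define r where "r i = i + (\<Sum>j\<le>i. N j)" for i
  have rN: "r i \<ge> N i" "r i \<ge> i" "r (Suc i) \<ge> r i" for i
    using member_le_sum [of i "{..i}" N] by (auto simp: r_def)
  have conv: "AE x in M. convergent (\<lambda>n. F (r n) x)"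
    by (rule fast_L2_Cauchy_AE_convergent)
       (use rN in \<open>auto intro!: N intro: order_trans\<close>)
  define f where "f x = lim (\<lambda>n. F (r n) x)" for x
  have [measurable]: "f \<in> borel_measurable M"
    unfolding f_def by measurable
  have lim: "AE x in M. (\<lambda>n. F (r n) x) \<longlonglongrightarrow> f x"
    using conv by eventually_elim (simp add: f_def convergent_LIMSEQ_iff)
  \<comment> \<open>Fatou is applied along the subsequence with \<open>m\<close> fixed; the
    conclusion therefore concerns the full sequence.\<close>
  have fatou: "L2_sqdist M (F m) f \<le> ennreal e"
    if "\<And>n. n \<ge> N0 \<Longrightarrow> L2_sqdist M (F m) (F n) \<le> ennreal e" for e m N0
  proof -
    have "L2_sqdist M (F m) f = (\<integral>\<^sup>+x. liminf (\<lambda>n. ennreal ((F m x - F (r n) x)\<^sup>2)) \<partial>M)"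
      using lim
    proof (intro nn_integral_cong_AE, eventually_elim)
      fix x assume "(\<lambda>n. F (r n) x) \<longlonglongrightarrow> f x"
      then have "(\<lambda>n. ennreal ((F m x - F (r n) x)\<^sup>2)) \<longlonglongrightarrow> ennreal ((F m x - f x)\<^sup>2)"
        by (intro tendsto_intros tendsto_ennrealI)
      then show "ennreal ((F m x - f x)\<^sup>2) = liminf (\<lambda>n. ennreal ((F m x - F (r n) x)\<^sup>2))"
        by (intro lim_imp_Liminf [symmetric]) auto
    qed
    also have "\<dots> \<le> liminf (\<lambda>n. L2_sqdist M (F m) (F (r n)))"
      by (rule nn_integral_liminf) auto
    also have "\<dots> \<le> liminf (\<lambda>n. ennreal e)"
      using that rN(2) order_trans
      by (intro Liminf_mono) (auto simp: eventually_sequentially, blast)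
    finally show ?thesis by (simp add: Liminf_const)
  qed
  have tl: "tendsto_L2 M F f"
    unfolding tendsto_L2_def
  proof (rule order_tendstoI)
    fix a :: ennreal assume "0 < a"
    then obtain e where e: "0 < ennreal e" "ennreal e < a"
      by (metis dense ennreal_cases less_top_ennreal top.not_eq_extremum dual_order.strict_trans)
    then obtain N0 where "\<And>m n. m \<ge> N0 \<Longrightarrow> n \<ge> N0 \<Longrightarrow> L2_sqdist M (F m) (F n) \<le> ennreal e"
      using Cauchy [of e] by auto
    then have "L2_sqdist M (F m) f \<le> ennreal e" if "m \<ge> N0" for m
      using that by (intro fatou [of N0]) auto
    then show "\<forall>\<^sub>F n in sequentially. L2_sqdist M (F n) f < a"
      using e unfolding eventually_sequentially by (meson order_le_less_trans)
  qed auto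
  have "square_integrable M f"
  proof -
    obtain N0 where N0: "L2_sqdist M (F m) f < 1" if "m \<ge> N0" for m
      using order_tendstoD(2) [OF tl [unfolded tendsto_L2_def], of 1]
      by (auto simp: eventually_sequentially)
    have "L2_sqdist M f (\<lambda>_. 0) \<le> 2 * L2_sqdist M f (F N0) + 2 * L2_sqdist M (F N0) (\<lambda>_. 0)"
      by (rule L2_sqdist_triangle) auto
    also have "\<dots> < \<infinity>"
    proof -
      have "L2_sqdist M f (F N0) < \<infinity>" "L2_sqdist M (F N0) (\<lambda>_. 0) < \<infinity>"
        using order.strict_trans [OF N0 [of N0], of \<infinity>] sq [of N0] L2_sqdist_commute [of M f "F N0"]
        by (auto simp: square_integrable_iff_nn_integral)
      then show ?thesis by (auto simp: ennreal_mult_less_top)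
    qed
    finally show ?thesis by (simp add: square_integrable_iff_nn_integral)
  qed
  with tl show ?thesis using that by blast
qed

section \<open>Joint laws and limits in mean square\<close>

lemma ennreal_tendsto_0_mono:
  fixes f g :: "nat \<Rightarrow> ennreal"
  assumes "\<And>n. f n \<le> g n" "g \<longlonglongrightarrow> 0"
  shows "f \<longlonglongrightarrow> 0"
  by (rule tendsto_sandwich [OF _ _ tendsto_const assms(2)]) (auto simp: assms(1))

text \<open>The orthants bounded above by \<open>a\<close> are stable under intersection and
  generate the finite product sigma-algebra, so a joint distribution function determines the
  law.\<close>

lemma borel_PiM_eqI_atMost:
  fixes P Q :: "('i \<Rightarrow> real) measure"
  assumes J: "finite J" and P: "sets P = sets (Pi\<^sub>M J (\<lambda>_. borel))" "finite_measure P"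
    and Q: "sets Q = sets (Pi\<^sub>M J (\<lambda>_. borel))"
    and eq: "\<And>a. emeasure P (\<Pi>\<^sub>E i\<in>J. {..a i}) = emeasure Q (\<Pi>\<^sub>E i\<in>J. {..a i})"
  shows "P = Q"
proof -
  interpret finite_measure P by fact
  define E where "E = (range (\<lambda>a. \<Pi>\<^sub>E i\<in>J. {..a i}) :: ('i \<Rightarrow> real) set set)"
  have "E = {{f \<in> (\<Pi>\<^sub>E i\<in>J. UNIV). \<forall>i\<in>j. f i \<in> A i} | A j. j \<in> {J} \<and> A \<in> Pi j (\<lambda>_. range atMost)}" (is "_ = ?P")
  proof
    show "E \<subseteq> ?P"
    proof
      fix X assume "X \<in> E"
      then obtain a :: "'i \<Rightarrow> real" where "X = (\<Pi>\<^sub>E i\<in>J. {..a i})" by (auto simp: E_def)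
      then have "X = {f \<in> (\<Pi>\<^sub>E i\<in>J. UNIV). \<forall>i\<in>J. f i \<in> {..a i}}"
        by (auto simp: PiE_def)
      then show "X \<in> ?P"
        by (intro CollectI exI [of _ "\<lambda>i. {..a i}"] exI [of _ J]) auto
    qed
    show "?P \<subseteq> E"
    proof clarify
      fix A :: "'i \<Rightarrow> real set" assume "A \<in> Pi J (\<lambda>_. range atMost)"
      then have "\<forall>i\<in>J. \<exists>a. A i = {..a}" by auto
      then obtain a where "\<And>i. i \<in> J \<Longrightarrow> A i = {..a i}" by metis
      then have "{f \<in> (\<Pi>\<^sub>E i\<in>J. UNIV). \<forall>i\<in>J. f i \<in> A i} = (\<Pi>\<^sub>E i\<in>J. {..a i})"
        by (auto simp: PiE_def)
      then show "{f \<in> (\<Pi>\<^sub>E i\<in>J. UNIV). \<forall>i\<in>J. f i \<in> A i} \<in> E"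
        by (auto simp: E_def)
    qed
  qed
  moreover have "?P \<subseteq> Pow (\<Pi>\<^sub>E i\<in>J. UNIV)"
    by auto
  moreover have "sets (\<Pi>\<^sub>M i\<in>J. sigma (UNIV :: real set) (range atMost)) = sets (sigma (\<Pi>\<^sub>E i\<in>J. UNIV) ?P)"
  proof (rule sets_PiM_sigma)
    show "\<exists>S\<subseteq>range atMost. countable S \<and> (UNIV :: real set) = \<Union>S"
      by (rule exI [of _ "range (\<lambda>n. {..real n})"]) (auto intro: real_arch_simple)
  qed (use J in auto)
  ultimately have sets: "sets (Pi\<^sub>M J (\<lambda>_. borel :: real measure)) = sigma_sets (\<Pi>\<^sub>E i\<in>J. UNIV) E"
    by (simp only: borel_eq_atMost sets_measure_of image_Collect full_SetCompr_eq [symmetric])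
  show ?thesis
  proof (rule measure_eqI_generator_eq)
    show "Int_stable E"
    proof (rule Int_stableI)
      fix X Y assume "X \<in> E" "Y \<in> E"
      then obtain a b :: "'i \<Rightarrow> real" where
        "X = (\<Pi>\<^sub>E i\<in>J. {..a i})" "Y = (\<Pi>\<^sub>E i\<in>J. {..b i})" by (auto simp: E_def)
      then have "X \<inter> Y = (\<Pi>\<^sub>E i\<in>J. {..min (a i) (b i)})" by (auto simp: PiE_def Pi_def)
      then show "X \<inter> Y \<in> E" by (auto simp: E_def)
    qed
    show "E \<subseteq> Pow (\<Pi>\<^sub>E i\<in>J. UNIV)"
      by (auto simp: E_def PiE_def)
    show "emeasure P X = emeasure Q X" if "X \<in> E" for X
      using that eq by (auto simp: E_def)
    show "range (\<lambda>n. \<Pi>\<^sub>E i\<in>J. {..real n}) \<subseteq> E" by (auto simp: E_def)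
    show "(\<Union>n. \<Pi>\<^sub>E i\<in>J. {..real n}) = (\<Pi>\<^sub>E i\<in>J. UNIV)"
    proof (intro equalityI subsetI)
      fix f :: "'i \<Rightarrow> real" assume f: "f \<in> (\<Pi>\<^sub>E i\<in>J. UNIV)"
      obtain n where n: "(\<Sum>i\<in>J. \<bar>f i\<bar>) \<le> real n" using real_arch_simple by blast
      have "f i \<le> real n" if "i \<in> J" for i
        using member_le_sum [of i J "\<lambda>i. \<bar>f i\<bar>"] that n J by (auto simp: abs_le_iff)
      with f show "f \<in> (\<Union>n. \<Pi>\<^sub>E i\<in>J. {..real n})" by (auto simp: PiE_def)
    qed (auto simp: PiE_def)
  qed (auto simp: P Q sets)
qed

text \<open>For \<open>n > 0\<close> a continuous cutoff: 1 up to \<open>a\<close>, 0 beyond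
  \<open>a + 1/n\<close>, linear in between. Its Lipschitz constant \<open>n\<close> is what lets
  mean-square errors control expectations.\<close>

definition ramp :: "nat \<Rightarrow> real \<Rightarrow> real \<Rightarrow> real" where
  "ramp n a x = max 0 (min 1 (1 - real n * (x - a)))"

lemma ramp_bounds: "0 \<le> ramp n a x" "ramp n a x \<le> 1"
  by (auto simp: ramp_def)

lemma ramp_measurable [measurable]: "ramp n a \<in> borel_measurable borel"
  unfolding ramp_def by measurable

lemma ramp_lipschitz: "\<bar>ramp n a x - ramp n a y\<bar> \<le> real n * \<bar>x - y\<bar>"
proof -
  have "\<bar>ramp n a x - ramp n a y\<bar> \<le> \<bar>real n * (x - a) - real n * (y - a)\<bar>"
    unfolding ramp_def by linarith
  also have "\<dots> = real n * \<bar>x - y\<bar>"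
    by (simp add: abs_mult flip: right_diff_distrib)
  finally show ?thesis .
qed

lemma ramp_tendsto_indicator: "(\<lambda>n. ramp n a x) \<longlonglongrightarrow> indicator {..a} x"
proof (cases "x \<le> a")
  case True
  then have "ramp n a x = 1" for n
    by (simp add: ramp_def mult_nonneg_nonpos min_def max_def)
  with True show ?thesis by simp
next
  case False
  then obtain N where N: "1 < real N * (x - a)"
    using reals_Archimedean3 [of "x - a"] by auto
  have "\<forall>\<^sub>F n in sequentially. ramp n a x = 0"
    unfolding eventually_sequentially
  proof (intro exI allI impI)
    fix n assume "N \<le> n"
    then have "real N * (x - a) \<le> real n * (x - a)"
      using False by (intro mult_right_mono) auto
    with N show "ramp n a x = 0" by (simp add: ramp_def)
  qed
  with False show ?thesis by (simp add: tendsto_eventually)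
qed

text \<open>For factors in [0,1] the difference of two products is at most the sum of the
  differences of the factors; Cauchy-Schwarz against the constant \<open>n\<close> gives
  \<open>card J\<close> times n squared.\<close>

lemma prod_ramp_lipschitz:
  "((\<Prod>i\<in>J. ramp n (a i) (v i)) - (\<Prod>i\<in>J. ramp n (a i) (w i)))\<^sup>2
    \<le> real (card J) * (real n)\<^sup>2 * (\<Sum>i\<in>J. (v i - w i)\<^sup>2)"
proof -
  have "\<bar>(\<Prod>i\<in>J. ramp n (a i) (v i)) - (\<Prod>i\<in>J. ramp n (a i) (w i))\<bar>
      \<le> (\<Sum>i\<in>J. \<bar>ramp n (a i) (v i) - ramp n (a i) (w i)\<bar>)"
    using norm_prod_diff [of J "\<lambda>i. ramp n (a i) (v i)" "\<lambda>i. ramp n (a i) (w i)"] ramp_bounds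
    by simp
  also have "\<dots> \<le> (\<Sum>i\<in>J. real n * \<bar>v i - w i\<bar>)"
    by (intro sum_mono ramp_lipschitz)
  finally have "((\<Prod>i\<in>J. ramp n (a i) (v i)) - (\<Prod>i\<in>J. ramp n (a i) (w i)))\<^sup>2
      \<le> (\<Sum>i\<in>J. real n * \<bar>v i - w i\<bar>)\<^sup>2"
    using power_mono [OF _ abs_ge_zero, of _ _ 2] by fastforce
  also have "\<dots> \<le> (\<Sum>i\<in>J. (real n)\<^sup>2) * (\<Sum>i\<in>J. \<bar>v i - w i\<bar>\<^sup>2)"
    by (rule Cauchy_Schwarz_ineq_sum)
  finally show ?thesis by simp
qed

lemma (in prob_space) expectation_prod_ramp_tendsto:
  assumes J: "finite J"
    and [measurable]: "\<And>i. i \<in> J \<Longrightarrow> X i \<in> borel_measurable M"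
      "\<And>i m. i \<in> J \<Longrightarrow> XX i m \<in> borel_measurable M"
    and lim: "\<And>i. i \<in> J \<Longrightarrow> tendsto_L2 M (XX i) (X i)"
  shows "(\<lambda>m. expectation (\<lambda>\<omega>. \<Prod>i\<in>J. ramp n (a i) (XX i m \<omega>)))
    \<longlonglongrightarrow> expectation (\<lambda>\<omega>. \<Prod>i\<in>J. ramp n (a i) (X i \<omega>))"
proof -
  define D where "D m \<omega> = (\<Prod>i\<in>J. ramp n (a i) (XX i m \<omega>)) - (\<Prod>i\<in>J. ramp n (a i) (X i \<omega>))" for m \<omega>
  have [measurable]: "D m \<in> borel_measurable M" for m
    unfolding D_def by measurable
  have prod01: "0 \<le> (\<Prod>i\<in>J. ramp n (a i) (v i))" "(\<Prod>i\<in>J. ramp n (a i) (v i)) \<le> 1" for v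
    by (auto intro!: prod_nonneg prod_le_1 ramp_bounds)
  have int: "integrable M (\<lambda>\<omega>. \<Prod>i\<in>J. ramp n (a i) (XX i m \<omega>))"
      "integrable M (\<lambda>\<omega>. \<Prod>i\<in>J. ramp n (a i) (X i \<omega>))" for m
    by (rule integrable_const_bound [where B = 1]; use prod01 in simp)+
  have D1: "\<bar>D m \<omega>\<bar> \<le> 1" for m \<omega>
    using prod01 [of "\<lambda>i. XX i m \<omega>"] prod01 [of "\<lambda>i. X i \<omega>"] unfolding D_def by linarith
  have intD: "integrable M (D m)" "integrable M (\<lambda>\<omega>. (D m \<omega>)\<^sup>2)" for m
    using D1 by (auto intro!: integrable_const_bound [where B = 1] simp: abs_square_le_1)
  have bound: "ennreal (expectation (\<lambda>\<omega>. (D m \<omega>)\<^sup>2))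
      \<le> ennreal (real (card J) * (real n)\<^sup>2) * (\<Sum>i\<in>J. L2_sqdist M (XX i m) (X i))" for m
  proof -
    have "ennreal (expectation (\<lambda>\<omega>. (D m \<omega>)\<^sup>2)) = (\<integral>\<^sup>+\<omega>. ennreal ((D m \<omega>)\<^sup>2) \<partial>M)"
      using intD by (intro nn_integral_eq_integral [symmetric]) auto
    also have "\<dots> \<le> (\<integral>\<^sup>+\<omega>. ennreal (real (card J) * (real n)\<^sup>2) * (\<Sum>i\<in>J. ennreal ((XX i m \<omega> - X i \<omega>)\<^sup>2)) \<partial>M)"
      unfolding D_def
      by (intro nn_integral_mono)
         (auto simp: sum_nonneg simp flip: ennreal_mult intro!: ennreal_leI prod_ramp_lipschitz)
    also have "\<dots> = ennreal (real (card J) * (real n)\<^sup>2) * (\<Sum>i\<in>J. L2_sqdist M (XX i m) (X i))"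
      by (subst nn_integral_cmult, measurable, subst nn_integral_sum) auto
    finally show ?thesis .
  qed
  have "(\<lambda>m. ennreal (real (card J) * (real n)\<^sup>2) * (\<Sum>i\<in>J. L2_sqdist M (XX i m) (X i)))
      \<longlonglongrightarrow> ennreal (real (card J) * (real n)\<^sup>2) * (\<Sum>i\<in>J. 0)"
    using lim by (intro ennreal_tendsto_cmult tendsto_sum) (auto simp: tendsto_L2_def)
  then have "(\<lambda>m. ennreal (real (card J) * (real n)\<^sup>2) * (\<Sum>i\<in>J. L2_sqdist M (XX i m) (X i)))
      \<longlonglongrightarrow> 0"
    by simp
  from ennreal_tendsto_0_mono [OF bound this]
  have "(\<lambda>m. ennreal (expectation (\<lambda>\<omega>. (D m \<omega>)\<^sup>2))) \<longlonglongrightarrow> ennreal 0"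
    by simp
  then have D2: "(\<lambda>m. expectation (\<lambda>\<omega>. (D m \<omega>)\<^sup>2)) \<longlonglongrightarrow> 0"
    by (subst (asm) tendsto_ennreal_iff) auto
  \<comment> \<open>Nonnegativity of the variance: convergence in mean square gives convergence of
    the mean.\<close>
  have "(expectation (D m))\<^sup>2 \<le> expectation (\<lambda>\<omega>. (D m \<omega>)\<^sup>2)" for m
    using variance_eq [OF intD(1,2)] variance_positive [of "D m"] by simp
  then have "(\<lambda>m. (expectation (D m))\<^sup>2) \<longlonglongrightarrow> 0"
    by (intro tendsto_sandwich [OF _ _ tendsto_const D2]) auto
  then have "(\<lambda>m. expectation (D m)) \<longlonglongrightarrow> 0"
    using tendsto_real_sqrt [of "\<lambda>m. (expectation (D m))\<^sup>2" 0]
    by (simp add: tendsto_rabs_zero_iff)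
  then have "(\<lambda>m. expectation (D m) + expectation (\<lambda>\<omega>. \<Prod>i\<in>J. ramp n (a i) (X i \<omega>)))
      \<longlonglongrightarrow> 0 + expectation (\<lambda>\<omega>. \<Prod>i\<in>J. ramp n (a i) (X i \<omega>))"
    by (intro tendsto_add tendsto_const)
  moreover have "expectation (D m) = expectation (\<lambda>\<omega>. \<Prod>i\<in>J. ramp n (a i) (XX i m \<omega>))
      - expectation (\<lambda>\<omega>. \<Prod>i\<in>J. ramp n (a i) (X i \<omega>))" for m
    using int by (simp add: D_def [abs_def])
  ultimately show ?thesis by simp
qed

text \<open>The ramps converge to the indicator at every point, the corner included, so the limit is
  the distribution function everywhere; no continuity points have to be singled out.\<close>

lemma (in prob_space) expectation_prod_ramp_tendsto_prob:
  assumes J: "finite J" and [measurable]: "\<And>i. i \<in> J \<Longrightarrow> X i \<in> borel_measurable M"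
  shows "(\<lambda>n. expectation (\<lambda>\<omega>. \<Prod>i\<in>J. ramp n (a i) (X i \<omega>)))
    \<longlonglongrightarrow> measure (distr M (Pi\<^sub>M J (\<lambda>_. borel)) (\<lambda>\<omega>. \<lambda>i\<in>J. X i \<omega>)) (\<Pi>\<^sub>E i\<in>J. {..a i})"
proof -
  have "(\<lambda>n. expectation (\<lambda>\<omega>. \<Prod>i\<in>J. ramp n (a i) (X i \<omega>)))
      \<longlonglongrightarrow> expectation (\<lambda>\<omega>. \<Prod>i\<in>J. indicator {..a i} (X i \<omega>))"
    by (rule integral_dominated_convergence [where w = "\<lambda>_. 1"])
       (auto intro!: tendsto_prod ramp_tendsto_indicator prod_le_1 ramp_bounds
             simp: abs_prod ramp_bounds)
  also have "expectation (\<lambda>\<omega>. \<Prod>i\<in>J. indicator {..a i} (X i \<omega>) :: real)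
      = expectation (indicator {\<omega> \<in> space M. \<forall>i\<in>J. X i \<omega> \<le> a i})"
  proof (intro Bochner_Integration.integral_cong refl)
    fix \<omega> assume "\<omega> \<in> space M"
    then show "(\<Prod>i\<in>J. indicator {..a i} (X i \<omega>)) = (indicator {\<omega> \<in> space M. \<forall>i\<in>J. X i \<omega> \<le> a i} \<omega> :: real)"
      using J by (auto simp: indicator_def)
  qed
  also have "\<dots> = prob {\<omega> \<in> space M. \<forall>i\<in>J. X i \<omega> \<le> a i}"
    using Bochner_Integration.integral_indicator [of M "{\<omega> \<in> space M. \<forall>i\<in>J. X i \<omega> \<le> a i}"]
    by (simp add: Int_absorb2)
  also have "{\<omega> \<in> space M. \<forall>i\<in>J. X i \<omega> \<le> a i} = (\<lambda>\<omega>. \<lambda>i\<in>J. X i \<omega>) -` (\<Pi>\<^sub>E i\<in>J. {..a i}) \<inter> space M"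
    by auto
  also have "prob \<dots> = measure (distr M (Pi\<^sub>M J (\<lambda>_. borel)) (\<lambda>\<omega>. \<lambda>i\<in>J. X i \<omega>)) (\<Pi>\<^sub>E i\<in>J. {..a i})"
    using J by (subst measure_distr) (auto intro!: sets_PiM_I_finite)
  finally show ?thesis .
qed

text \<open>The order of limits matters: \<open>m\<close> goes to infinity while the sharpness
  \<open>n\<close> of the ramps is fixed, where the Lipschitz bound applies; \<open>n\<close> goes
  to infinity afterwards, which yields equal distribution functions.\<close>

proposition (in prob_space) distr_eq_of_tendsto_L2:
  assumes J: "finite J"
    and X [measurable]: "\<And>i. i \<in> J \<Longrightarrow> X i \<in> borel_measurable M" "\<And>i. i \<in> J \<Longrightarrow> Y i \<in> borel_measurable M"
    and XX [measurable]: "\<And>i m. i \<in> J \<Longrightarrow> XX i m \<in> borel_measurable M"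
      "\<And>i m. i \<in> J \<Longrightarrow> YY i m \<in> borel_measurable M"
    and lim: "\<And>i. i \<in> J \<Longrightarrow> tendsto_L2 M (XX i) (X i)" "\<And>i. i \<in> J \<Longrightarrow> tendsto_L2 M (YY i) (Y i)"
    and eq: "\<And>m. distr M (Pi\<^sub>M J (\<lambda>_. borel)) (\<lambda>\<omega>. \<lambda>i\<in>J. XX i m \<omega>)
      = distr M (Pi\<^sub>M J (\<lambda>_. borel)) (\<lambda>\<omega>. \<lambda>i\<in>J. YY i m \<omega>)"
  shows "distr M (Pi\<^sub>M J (\<lambda>_. borel)) (\<lambda>\<omega>. \<lambda>i\<in>J. X i \<omega>)
    = distr M (Pi\<^sub>M J (\<lambda>_. borel)) (\<lambda>\<omega>. \<lambda>i\<in>J. Y i \<omega>)" (is "?PX = ?PY")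
proof -
  have E: "expectation (\<lambda>\<omega>. \<Prod>i\<in>J. ramp n (a i) (U i \<omega>))
      = (\<integral>v. (\<Prod>i\<in>J. ramp n (a i) (v i)) \<partial>distr M (Pi\<^sub>M J (\<lambda>_. borel)) (\<lambda>\<omega>. \<lambda>i\<in>J. U i \<omega>))"
    if [measurable]: "\<And>i. i \<in> J \<Longrightarrow> U i \<in> borel_measurable M" for U n a
    by (subst integral_distr) (auto intro!: Bochner_Integration.integral_cong)
  have "expectation (\<lambda>\<omega>. \<Prod>i\<in>J. ramp n (a i) (XX i m \<omega>))
      = expectation (\<lambda>\<omega>. \<Prod>i\<in>J. ramp n (a i) (YY i m \<omega>))" for n m a
    using E [of "\<lambda>i. XX i m"] E [of "\<lambda>i. YY i m"] eq [of m] XX by simp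
  then have *: "expectation (\<lambda>\<omega>. \<Prod>i\<in>J. ramp n (a i) (X i \<omega>))
      = expectation (\<lambda>\<omega>. \<Prod>i\<in>J. ramp n (a i) (Y i \<omega>))" for n a
    using LIMSEQ_unique [OF expectation_prod_ramp_tendsto [of J X XX n a] ]
      expectation_prod_ramp_tendsto [of J Y YY n a] J X XX lim by auto
  have meas: "measure ?PX (\<Pi>\<^sub>E i\<in>J. {..a i}) = measure ?PY (\<Pi>\<^sub>E i\<in>J. {..a i})" for a
    using LIMSEQ_unique [OF expectation_prod_ramp_tendsto_prob [of J X a]]
      expectation_prod_ramp_tendsto_prob [of J Y a] J X * by auto
  interpret PX: prob_space ?PX by (rule prob_space_distr) measurable
  interpret PY: prob_space ?PY by (rule prob_space_distr) measurable
  show ?thesis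
    by (rule borel_PiM_eqI_atMost [OF J])
       (auto simp: PX.emeasure_eq_measure PY.emeasure_eq_measure meas PX.finite_measure_axioms)
qed

section \<open>Grid sums and refinement\<close>

text \<open>Step functions and their integrals are both of this form: for \<open>f i r = indicator {x $ i..} r\<close>
  it is the step function at \<open>x\<close>, and for \<open>f i r = W r \<omega>\<close> it is the integral.\<close>

definition grid_sum ::
    "(nat \<Rightarrow> real) \<Rightarrow> nat \<Rightarrow> (('k::finite \<Rightarrow> nat) \<Rightarrow> real) \<Rightarrow> ('k \<Rightarrow> real \<Rightarrow> real) \<Rightarrow> real" where
  "grid_sum t n c f = (\<Sum>j\<in>off_diagonal_indices n. c j * (\<Prod>i\<in>UNIV. f i (t (Suc (j i))) - f i (t (j i))))"

lemma step_integral_eq_grid_sum: "step_integral W t n c \<omega> = grid_sum t n c (\<lambda>i r. W r \<omega>)"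
  by (simp add: step_integral_def grid_sum_def)

lemma step_function_eq_grid_sum:
  assumes "strict_mono t"
  shows "step_function t n c x = grid_sum t n c (\<lambda>i. indicator {x $ i..})"
proof -
  have "indicator {t l<..t (Suc l)} y = (indicator {y..} (t (Suc l)) - indicator {y..} (t l) :: real)" for l y
    using strict_monoD [OF assms, of l "Suc l"] by (auto simp: indicator_def)
  then show ?thesis
    by (simp add: step_function_def grid_sum_def)
qed

lemma grid_sum_diff: "grid_sum t n (\<lambda>j. c j - d j) f = grid_sum t n c f - grid_sum t n d f"
  by (simp add: grid_sum_def left_diff_distrib sum_subtractf)

lemma grid_sum_cmult: "grid_sum t n (\<lambda>j. d * c j) f = d * grid_sum t n c f"
  by (simp add: grid_sum_def sum_distrib_left mult.assoc)

lemma finite_off_diagonal_indices [simp]: "finite (off_diagonal_indices n :: ('k::finite \<Rightarrow> nat) set)"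
proof (rule finite_subset)
  show "(off_diagonal_indices n :: ('k \<Rightarrow> nat) set) \<subseteq> (\<Pi>\<^sub>E i\<in>UNIV. {..<n})"
    by (auto simp: off_diagonal_indices_def)
qed (simp add: finite_PiE)

text \<open>\<open>p l\<close> is the position of the coarse node \<open>l\<close> in the fine grid.
  A fine cell inherits the coefficient of the coarse cell that contains it; a fine cell with two
  indices inside one coarse interval lies in no admissible coarse cell and gets 0.\<close>

definition refine_coeffs ::
    "(nat \<Rightarrow> nat) \<Rightarrow> nat \<Rightarrow> (('k::finite \<Rightarrow> nat) \<Rightarrow> real) \<Rightarrow> ('k \<Rightarrow> nat) \<Rightarrow> real" where
  "refine_coeffs p n c m =
     (\<Sum>j\<in>off_diagonal_indices n. if \<forall>i. m i \<in> {p (j i)..<p (Suc (j i))} then c j else 0)"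

text \<open>Each coarse increment telescopes into fine ones, and the product of these sums is
  expanded. The argument is pure algebra in \<open>f\<close>, so a single set of coefficients
  refines a step function and its integral simultaneously.\<close>

lemma grid_sum_refine:
  fixes c :: "('k::finite \<Rightarrow> nat) \<Rightarrow> real"
  assumes p: "\<And>i j. i < j \<Longrightarrow> j \<le> n \<Longrightarrow> p i < p j" "p n \<le> N"
    and t: "\<And>i. i \<le> n \<Longrightarrow> t i = T (p i)"
  shows "grid_sum t n c f = grid_sum T N (refine_coeffs p n c) f"
proof -
  have p_le: "p i \<le> p j" if "i \<le> j" "j \<le> n" for i j
    using p(1) [of i j] that by (cases "i = j") auto
  define a where "a i l = f i (T (Suc l)) - f i (T l)" for i l
  define B where "B j = (\<Pi>\<^sub>E i\<in>UNIV. {p (j i)..<p (Suc (j i))})" for j :: "'k \<Rightarrow> nat"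
  have B_sub: "B j \<subseteq> off_diagonal_indices N" if j: "j \<in> off_diagonal_indices n" for j
  proof
    fix m assume m: "m \<in> B j"
    then have mi: "p (j i) \<le> m i" "m i < p (Suc (j i))" for i
      by (auto simp: B_def PiE_def Pi_def)
    have jn: "j i < n" for i using j by (auto simp: off_diagonal_indices_def)
    \<comment> \<open>Distinct coarse intervals share no fine interval, so equal fine indices come
      from equal coarse ones; injectivity thus passes from \<open>j\<close> to
      \<open>m\<close>.\<close>
    have le: "\<not> j i < j i'" if "m i = m i'" for i i'
    proof
      assume "j i < j i'"
      then have "p (Suc (j i)) \<le> p (j i')"
        using jn [of i'] by (intro p_le) auto
      with mi [of i] mi [of i'] that show False by auto
    qed
    have "inj m"
    proof (rule injI)
      fix i i' assume "m i = m i'"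
      with le [of i i'] le [of i' i] have "j i = j i'" by auto
      with j show "i = i'" by (auto simp: off_diagonal_indices_def inj_def)
    qed
    moreover have "m i < N" for i
      using mi(2) [of i] p_le [of "Suc (j i)" n] jn [of i] p(2) by auto
    ultimately show "m \<in> off_diagonal_indices N"
      by (auto simp: off_diagonal_indices_def)
  qed
  have "grid_sum t n c f = (\<Sum>j\<in>off_diagonal_indices n. c j * (\<Prod>i\<in>UNIV. \<Sum>l\<in>{p (j i)..<p (Suc (j i))}. a i l))"
    unfolding grid_sum_def
  proof (intro sum.cong refl arg_cong2 [where f = "(*)"] prod.cong)
    fix j :: "'k \<Rightarrow> nat" and i assume "j \<in> off_diagonal_indices n"
    then have "Suc (j i) \<le> n" by (auto simp: off_diagonal_indices_def Suc_le_eq)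
    then show "f i (t (Suc (j i))) - f i (t (j i)) = (\<Sum>l\<in>{p (j i)..<p (Suc (j i))}. a i l)"
      using t [of "j i"] t [of "Suc (j i)"] p_le [of "j i" "Suc (j i)"]
        sum_Suc_diff' [of "p (j i)" "p (Suc (j i))" "\<lambda>l. f i (T l)"]
      by (simp add: a_def)
  qed
  also have "\<dots> = (\<Sum>j\<in>off_diagonal_indices n. \<Sum>m\<in>B j. c j * (\<Prod>i\<in>UNIV. a i (m i)))"
    by (simp add: prod_sum_PiE B_def sum_distrib_left)
  also have "\<dots> = (\<Sum>j\<in>off_diagonal_indices n. \<Sum>m\<in>off_diagonal_indices N.
      if m \<in> B j then c j * (\<Prod>i\<in>UNIV. a i (m i)) else 0)"
    using B_sub by (intro sum.cong [OF refl]) (simp add: sum.If_cases Int_absorb1)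
  also have "\<dots> = (\<Sum>m\<in>off_diagonal_indices N. \<Sum>j\<in>off_diagonal_indices n.
      if m \<in> B j then c j * (\<Prod>i\<in>UNIV. a i (m i)) else 0)"
    by (rule sum.swap)
  also have "\<dots> = grid_sum T N (refine_coeffs p n c) f"
    unfolding grid_sum_def refine_coeffs_def sum_distrib_right
    by (intro sum.cong refl) (auto simp: B_def a_def PiE_def Pi_def)
  finally show ?thesis .
qed

lemma finite_subset_grid:
  fixes S :: "real set"
  assumes "finite S"
  obtains T :: "nat \<Rightarrow> real" and N where "strict_mono T" "S \<subseteq> T ` {..N}"
proof -
  define xs where "xs = sorted_list_of_set S"
  have xs: "sorted_wrt (<) xs" "set xs = S"
    using assms by (auto simp: xs_def)
  \<comment> \<open>A grid is an infinite strictly increasing sequence, so a tail is needed beyond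
    the points of \<open>S\<close>; it starts above every element of \<open>S\<close>.\<close>
  define T where "T l = (if l < length xs then xs ! l else (\<Sum>x\<in>S. \<bar>x\<bar>) + 1 + real l)" for l
  have le: "x \<le> (\<Sum>x\<in>S. \<bar>x\<bar>)" if "x \<in> S" for x
    using member_le_sum [of x S abs] that assms by force
  have "T l < T (Suc l)" for l
  proof -
    consider "Suc l < length xs" | "Suc l = length xs" | "length xs \<le> l" by linarith
    then show ?thesis
    proof cases
      case 1 then show ?thesis
        using sorted_wrt_nth_less [OF xs(1), of l "Suc l"] by (simp add: T_def)
    next
      case 2 then show ?thesis
        using le [of "xs ! l"] nth_mem [of l xs] xs(2) by (simp add: T_def)
    qed (simp add: T_def)
  qed
  then have "strict_mono T" by (simp add: strict_mono_Suc_iff)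
  moreover have "S \<subseteq> T ` {..length xs}"
  proof
    fix x assume "x \<in> S"
    then obtain l where "l < length xs" "xs ! l = x"
      using xs(2) by (metis in_set_conv_nth)
    then show "x \<in> T ` {..length xs}" by (intro image_eqI [of _ _ l]) (auto simp: T_def)
  qed
  ultimately show ?thesis using that by blast
qed

text \<open>Joint laws of several integrals become comparable once all of them are functions of the
  same increments. The quantifier over \<open>f\<close> transfers the refinement to functions and
  integrals with the same coefficients \<open>c'\<close>.\<close>

proposition common_refinement:
  fixes c :: "'i \<Rightarrow> ('k::finite \<Rightarrow> nat) \<Rightarrow> real"
  assumes I: "finite I" and t: "\<And>i. i \<in> I \<Longrightarrow> strict_mono (t i)"
  obtains T N c' where "strict_mono T"
    "\<And>i f. i \<in> I \<Longrightarrow> grid_sum (t i) (n i) (c i) f = grid_sum T N (c' i) f"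
proof -
  obtain T :: "nat \<Rightarrow> real" and N where T: "strict_mono T" "(\<Union>i\<in>I. t i ` {..n i}) \<subseteq> T ` {..N}"
    by (rule finite_subset_grid [of "\<Union>i\<in>I. t i ` {..n i}"]) (use I in auto)
  have "\<exists>c'. \<forall>f. grid_sum (t i) (n i) (c i) f = grid_sum T N c' f" if i: "i \<in> I" for i
  proof -
    have "\<forall>l\<in>{..n i}. \<exists>q\<le>N. t i l = T q"
      using T(2) i by (fastforce simp: subset_eq)
    then obtain p where p: "\<And>l. l \<le> n i \<Longrightarrow> p l \<le> N" "\<And>l. l \<le> n i \<Longrightarrow> t i l = T (p l)"
      by (metis atMost_iff)
    have "p l < p m" if "l < m" "m \<le> n i" for l m
    proof -
      have "T (p l) < T (p m)"
        using strict_monoD [OF t [OF i] that(1)] p(2) [of l] p(2) [of m] that by simp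
      then show ?thesis using T(1) by (simp add: strict_mono_less)
    qed
    then have "grid_sum (t i) (n i) (c i) f = grid_sum T N (refine_coeffs p (n i) (c i)) f" for f
      using p by (intro grid_sum_refine) auto
    then show ?thesis by blast
  qed
  then obtain c' where "\<And>i f. i \<in> I \<Longrightarrow> grid_sum (t i) (n i) (c i) f = grid_sum T N (c' i) f"
    by metis
  with T(1) show ?thesis by (rule that)
qed

section \<open>The norm of a step function\<close>

text \<open>The half-open box is squeezed between the open and the closed box, which have the same
  volume.\<close>

lemma emeasure_lborel_half_open_box:
  fixes a b :: "'k::finite \<Rightarrow> real"
  assumes "\<And>i. a i \<le> b i"
  shows "emeasure lborel {x :: real ^ 'k. \<forall>i. a i < x $ i \<and> x $ i \<le> b i} = ennreal (\<Prod>i\<in>UNIV. b i - a i)"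
    and "{x :: real ^ 'k. \<forall>i. a i < x $ i \<and> x $ i \<le> b i} \<in> sets borel"
proof -
  let ?C = "{x :: real ^ 'k. \<forall>i. a i < x $ i \<and> x $ i \<le> b i}"
  let ?a = "\<chi> i. a i" and ?b = "\<chi> i. b i"
  show C: "?C \<in> sets borel" by measurable
  have "box ?a ?b \<subseteq> ?C" "?C \<subseteq> cbox ?a ?b"
    by (auto simp: mem_box_cart less_imp_le)
  then have "emeasure lborel (box ?a ?b) \<le> emeasure lborel ?C"
      "emeasure lborel ?C \<le> emeasure lborel (cbox ?a ?b)"
    using C by (auto intro!: emeasure_mono)
  moreover have "emeasure lborel (box ?a ?b) = emeasure lborel (cbox ?a ?b)"
    by (simp add: emeasure_lborel_box_eq emeasure_lborel_cbox_eq)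
  moreover have "emeasure lborel (cbox ?a ?b) = ennreal (measure lborel (cbox ?a ?b))"
    by (rule emeasure_eq_ennreal_measure) (simp add: emeasure_lborel_cbox_eq)
  moreover have "measure lborel (cbox ?a ?b) = (\<Prod>i\<in>UNIV. b i - a i)"
    using assms by (subst content_cbox_cart) (auto simp: interval_ne_empty_cart)
  ultimately show "emeasure lborel ?C = ennreal (\<Prod>i\<in>UNIV. b i - a i)" by simp
qed

lemma step_function_measurable [measurable]: "step_function t n c \<in> borel_measurable borel"
  unfolding step_function_def by measurable

lemma step_function_on_cell:
  fixes x :: "real ^ 'k::finite"
  assumes t: "strict_mono t" and j: "j \<in> off_diagonal_indices n"
    and x: "\<And>i. t (j i) < x $ i \<and> x $ i \<le> t (Suc (j i))"
  shows "step_function t n c x = c j"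
proof -
  have lt: "\<not> l < m" if "t m < y" "y \<le> t (Suc l)" for l m y
    using that strict_mono_less_eq [OF t, of "Suc l" m] by (auto simp: Suc_le_eq)
  have "(\<Prod>i\<in>UNIV. indicator {t (j' i)<..t (Suc (j' i))} (x $ i)) = (if j' = j then 1 else 0 :: real)"
    for j' :: "'k \<Rightarrow> nat"
  proof (cases "j' = j")
    case False
    then obtain i where "j' i \<noteq> j i" by blast
    then have "x $ i \<notin> {t (j' i)<..t (Suc (j' i))}"
      using lt [of "j i" "x $ i" "j' i"] lt [of "j' i" "x $ i" "j i"] x [of i] by force
    then have "indicator {t (j' i)<..t (Suc (j' i))} (x $ i) = (0 :: real)"
      by simp
    with False show ?thesis by (auto intro!: prod_zero)
  qed (use x in simp)
  then show ?thesis
    unfolding step_function_def using j by (simp add: if_distrib [of "(*) _"] cong: if_cong)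
qed

lemma step_function_off_cells:
  assumes "\<And>j. j \<in> off_diagonal_indices n \<Longrightarrow> \<exists>i. \<not> (t (j i) < x $ i \<and> x $ i \<le> t (Suc (j i)))"
  shows "step_function t n c x = 0"
proof -
  have "(\<Prod>i\<in>UNIV. indicator {t (j i)<..t (Suc (j i))} (x $ i)) = (0 :: real)"
    if j: "j \<in> off_diagonal_indices n" for j
  proof -
    obtain i where "x $ i \<notin> {t (j i)<..t (Suc (j i))}" using assms [OF j] by auto
    then have "indicator {t (j i)<..t (Suc (j i))} (x $ i) = (0 :: real)" by simp
    then show ?thesis by (auto intro!: prod_zero)
  qed
  then show ?thesis
    unfolding step_function_def by (intro sum.neutral ballI) (simp only: mult_zero_right)
qed

lemma step_function_power2:
  assumes t: "strict_mono t"
  shows "(step_function t n c x)\<^sup>2 = step_function t n (\<lambda>j. (c j)\<^sup>2) x"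
proof (cases "\<exists>j\<in>off_diagonal_indices n. \<forall>i. t (j i) < x $ i \<and> x $ i \<le> t (Suc (j i))")
  case True
  then obtain j where j: "j \<in> off_diagonal_indices n" "\<And>i. t (j i) < x $ i \<and> x $ i \<le> t (Suc (j i))"
    by blast
  show ?thesis by (simp only: step_function_on_cell [OF t j])
next
  case False
  then have "step_function t n c x = 0" for c
    by (intro step_function_off_cells) blast
  then show ?thesis by simp
qed

lemma nn_integral_step_function_power2:
  fixes c :: "('k::finite \<Rightarrow> nat) \<Rightarrow> real"
  assumes t: "strict_mono t"
  shows "(\<integral>\<^sup>+x. ennreal ((step_function t n c x)\<^sup>2) \<partial>lebesgue)
    = ennreal (\<Sum>j\<in>off_diagonal_indices n. (c j)\<^sup>2 * (\<Prod>i\<in>UNIV. t (Suc (j i)) - t (j i)))"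
proof -
  let ?C = "\<lambda>j. {x. \<forall>i. t (j i) < x $ i \<and> x $ i \<le> t (Suc (j i))}"
  have le: "t l \<le> t (Suc l)" for l using t by (simp add: strict_mono_less_eq)
  have "(\<integral>\<^sup>+x. ennreal ((step_function t n c x)\<^sup>2) \<partial>lebesgue)
      = (\<integral>\<^sup>+x. (\<Sum>j\<in>off_diagonal_indices n. ennreal ((c j)\<^sup>2) * indicator (?C j) x) \<partial>lborel)"
    unfolding nn_integral_completion
  proof (rule nn_integral_cong)
    fix x :: "real ^ 'k"
    have "(\<Prod>i\<in>UNIV. indicator {t (j i)<..t (Suc (j i))} (x $ i)) = (indicator (?C j) x :: real)" for j
      by (auto simp: indicator_def)
    then have "(step_function t n c x)\<^sup>2 = (\<Sum>j\<in>off_diagonal_indices n. (c j)\<^sup>2 * indicator (?C j) x)"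
      unfolding step_function_power2 [OF t] by (simp add: step_function_def)
    then show "ennreal ((step_function t n c x)\<^sup>2)
        = (\<Sum>j\<in>off_diagonal_indices n. ennreal ((c j)\<^sup>2) * indicator (?C j) x)"
      by (simp only:, subst sum_ennreal [symmetric]) (auto intro!: sum.cong simp: indicator_def)
  qed
  also have "\<dots> = (\<Sum>j\<in>off_diagonal_indices n. ennreal ((c j)\<^sup>2) * emeasure lborel (?C j))"
    using emeasure_lborel_half_open_box(2)
    by (subst nn_integral_sum) (auto intro!: sum.cong nn_integral_cmult_indicator)
  also have "\<dots> = (\<Sum>j\<in>off_diagonal_indices n. ennreal ((c j)\<^sup>2 * (\<Prod>i\<in>UNIV. t (Suc (j i)) - t (j i))))"
    using le by (intro sum.cong refl) (simp add: emeasure_lborel_half_open_box(1) ennreal_mult prod_nonneg)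
  also have "\<dots> = ennreal (\<Sum>j\<in>off_diagonal_indices n. (c j)\<^sup>2 * (\<Prod>i\<in>UNIV. t (Suc (j i)) - t (j i)))"
    using le by (intro sum_ennreal) (simp add: prod_nonneg)
  finally show ?thesis .
qed

section \<open>Step integrals with respect to Brownian motion\<close>

lemma brownian_motion_prob_space: "brownian_motion M W \<Longrightarrow> prob_space M"
  by (simp add: brownian_motion_def)

lemma brownian_motion_measurable: "brownian_motion M W \<Longrightarrow> W t \<in> borel_measurable M"
  by (simp add: brownian_motion_def)

lemma brownian_motion_distributed:
  "brownian_motion M W \<Longrightarrow> s < t \<Longrightarrow>
    distributed M lborel (\<lambda>\<omega>. W t \<omega> - W s \<omega>) (normal_density 0 (sqrt (t - s)))"
  by (simp add: brownian_motion_def)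

lemma brownian_motion_indep_vars:
  "brownian_motion M W \<Longrightarrow> strict_mono t \<Longrightarrow>
    prob_space.indep_vars M (\<lambda>_. borel) (\<lambda>i \<omega>. W (t (Suc i)) \<omega> - W (t i) \<omega>) {..<n::nat}"
  by (simp add: brownian_motion_def)

lemma step_integral_measurable:
  assumes "brownian_motion M W"
  shows "step_integral W t n c \<in> borel_measurable M"
proof -
  have [measurable]: "W r \<in> borel_measurable M" for r
    by (rule brownian_motion_measurable [OF assms])
  show ?thesis
    unfolding step_integral_def by measurable
qed

lemma brownian_increment_moments:
  assumes W: "brownian_motion M W" and st: "s < t"
  shows "integrable M (\<lambda>\<omega>. (W t \<omega> - W s \<omega>) ^ e)"
    and "(\<integral>\<omega>. (W t \<omega> - W s \<omega>) \<partial>M) = 0"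
    and "(\<integral>\<omega>. (W t \<omega> - W s \<omega>)\<^sup>2 \<partial>M) = t - s"
proof -
  interpret prob_space M by (rule brownian_motion_prob_space [OF W])
  have pos: "0 < sqrt (t - s)" using st by simp
  note D = brownian_motion_distributed [OF W st]
  show "integrable M (\<lambda>\<omega>. (W t \<omega> - W s \<omega>) ^ e)"
    using distributed_integrable [OF D, of "\<lambda>x. x ^ e"] integrable_normal_moment [OF pos, of 0 e]
    by simp
  show 0: "(\<integral>\<omega>. (W t \<omega> - W s \<omega>) \<partial>M) = 0"
    by (rule normal_distributed_expectation [OF pos D])
  show "(\<integral>\<omega>. (W t \<omega> - W s \<omega>)\<^sup>2 \<partial>M) = t - s"
    using normal_distributed_variance [OF pos D] 0 st by simp
qed

text \<open>Each increment occurs with exponent 0, 1 or 2 in the product, so its expectation vanishes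
  unless the two multi-indices use the same set of increments.\<close>

lemma brownian_product_moments:
  fixes j j' :: "'k::finite \<Rightarrow> nat"
  assumes W: "brownian_motion M W" and T: "strict_mono T"
    and j: "j \<in> off_diagonal_indices N" and j': "j' \<in> off_diagonal_indices N"
  defines "X \<equiv> \<lambda>l \<omega>. W (T (Suc l)) \<omega> - W (T l) \<omega>"
  shows "integrable M (\<lambda>\<omega>. (\<Prod>i\<in>UNIV. X (j i) \<omega>) * (\<Prod>i\<in>UNIV. X (j' i) \<omega>))" (is ?int)
    and "(\<integral>\<omega>. (\<Prod>i\<in>UNIV. X (j i) \<omega>) * (\<Prod>i\<in>UNIV. X (j' i) \<omega>) \<partial>M)
      = (if range j = range j' then \<Prod>i\<in>UNIV. T (Suc (j i)) - T (j i) else 0)" (is ?eq)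
proof -
  interpret prob_space M by (rule brownian_motion_prob_space [OF W])
  have lt: "T l < T (Suc l)" for l using strict_monoD [OF T, of l "Suc l"] by simp
  have sub: "range j \<subseteq> {..<N}" "range j' \<subseteq> {..<N}" and inj: "inj j" "inj j'"
    using j j' by (auto simp: off_diagonal_indices_def)
  \<comment> \<open>Products over coordinates become products over all grid intervals, the index set
    on which the increments are independent; intervals not hit contribute 1.\<close>
  have prod_range: "(\<Prod>i\<in>UNIV. x (k i)) = (\<Prod>l<N. if l \<in> range k then x l else 1)"
    if "range k \<subseteq> {..<N}" "inj k" for x :: "nat \<Rightarrow> real" and k :: "'k \<Rightarrow> nat"
  proof -
    have "(\<Prod>i\<in>UNIV. x (k i)) = (\<Prod>l\<in>range k. x l)"
      using that(2) by (simp add: prod.reindex)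
    also have "\<dots> = (\<Prod>l<N. if l \<in> range k then x l else 1)"
      using that(1) by (intro prod.mono_neutral_cong_left) auto
    finally show ?thesis .
  qed
  define e :: "nat \<Rightarrow> nat" where "e l = of_bool (l \<in> range j) + of_bool (l \<in> range j')" for l
  have prod_eq: "(\<Prod>i\<in>UNIV. X (j i) \<omega>) * (\<Prod>i\<in>UNIV. X (j' i) \<omega>) = (\<Prod>l<N. X l \<omega> ^ e l)" for \<omega>
    unfolding prod_range [OF sub(1) inj(1), of "\<lambda>l. X l \<omega>"] prod_range [OF sub(2) inj(2), of "\<lambda>l. X l \<omega>"]
      prod.distrib [symmetric]
    by (intro prod.cong) (auto simp: e_def power2_eq_square)
  have indep: "indep_vars (\<lambda>_. borel) (\<lambda>l \<omega>. X l \<omega> ^ e l) {..<N}"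
    using indep_vars_compose2 [OF brownian_motion_indep_vars [OF W T], where Y = "\<lambda>l x. x ^ e l" and N = "\<lambda>_. borel"]
    by (simp add: X_def)
  have int: "integrable M (\<lambda>\<omega>. X l \<omega> ^ e l)" for l
    unfolding X_def by (rule brownian_increment_moments(1) [OF W lt])
  show ?int
    unfolding prod_eq by (rule indep_vars_integrable [OF _ indep int]) auto
  have "(\<integral>\<omega>. (\<Prod>i\<in>UNIV. X (j i) \<omega>) * (\<Prod>i\<in>UNIV. X (j' i) \<omega>) \<partial>M) = (\<Prod>l<N. \<integral>\<omega>. X l \<omega> ^ e l \<partial>M)"
    unfolding prod_eq by (rule indep_vars_lebesgue_integral [OF _ indep int]) auto
  also have "\<dots> = (if range j = range j' then \<Prod>i\<in>UNIV. T (Suc (j i)) - T (j i) else 0)"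
  proof (cases "range j = range j'")
    case True
    have "(\<Prod>l<N. \<integral>\<omega>. X l \<omega> ^ e l \<partial>M) = (\<Prod>l<N. if l \<in> range j then T (Suc l) - T l else 1)"
    proof (intro prod.cong refl)
      fix l
      show "(\<integral>\<omega>. X l \<omega> ^ e l \<partial>M) = (if l \<in> range j then T (Suc l) - T l else 1)"
        using True brownian_increment_moments(3) [OF W lt [of l]]
        by (auto simp: e_def X_def prob_space numeral_2_eq_2 [symmetric])
    qed
    then show ?thesis
      using True prod_range [OF sub(1) inj(1), of "\<lambda>l. T (Suc l) - T l"] by simp
  next
    case False
    then obtain l where l: "l \<in> range j \<longleftrightarrow> l \<notin> range j'" by blast
    then have "e l = 1" "l < N" using sub by (auto simp: e_def)
    then have "(\<integral>\<omega>. X l \<omega> ^ e l \<partial>M) = 0"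
      using brownian_increment_moments(2) [OF W lt [of l]] by (simp add: X_def)
    with \<open>l < N\<close> have "(\<Prod>l<N. \<integral>\<omega>. X l \<omega> ^ e l \<partial>M) = 0"
      by (intro prod_zero) auto
    with False show ?thesis by simp
  qed
  finally show ?eq .
qed

text \<open>These are the rearrangements of \<open>j\<close>, in number the factorial of
  \<open>CARD('k)\<close>. Counting all maps into \<open>range j\<close> is cruder but suffices, as
  only a finite constant depending on k matters.\<close>

lemma card_same_range_le:
  fixes j :: "'k::finite \<Rightarrow> nat"
  assumes "j \<in> off_diagonal_indices N"
  shows "card {j' :: 'k \<Rightarrow> nat. j' \<in> off_diagonal_indices N \<and> range j' = range j} \<le> CARD('k) ^ CARD('k)"
proof -
  have "{j' :: 'k \<Rightarrow> nat. j' \<in> off_diagonal_indices N \<and> range j' = range j} \<subseteq> (\<Pi>\<^sub>E i\<in>UNIV. range j)"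
    by auto
  then have "card {j' :: 'k \<Rightarrow> nat. j' \<in> off_diagonal_indices N \<and> range j' = range j} \<le> card (\<Pi>\<^sub>E i\<in>(UNIV :: 'k set). range j)"
    by (rule card_mono [rotated]) (auto intro: finite_PiE)
  also have "\<dots> = CARD('k) ^ CARD('k)"
    using assms by (simp add: card_PiE off_diagonal_indices_def card_image)
  finally show ?thesis .
qed

text \<open>Products of increments over different sets of grid intervals are orthogonal. Within one
  set, the multi-indices are rearrangements of each other and their cells have equal volume, so 2 c
  c' <= c^2 + c'^2 charges each squared coefficient once for every rearrangement.\<close>

proposition step_integral_L2_bound:
  fixes c :: "('k::finite \<Rightarrow> nat) \<Rightarrow> real"
  assumes W: "brownian_motion M W" and T: "strict_mono T"
  shows "(\<integral>\<^sup>+\<omega>. ennreal ((step_integral W T N c \<omega>)\<^sup>2) \<partial>M)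
    \<le> of_nat (CARD('k) ^ CARD('k)) * (\<integral>\<^sup>+x. ennreal ((step_function T N c x)\<^sup>2) \<partial>lebesgue)"
proof -
  let ?I = "off_diagonal_indices N :: ('k \<Rightarrow> nat) set"
  define X where "X l \<omega> = W (T (Suc l)) \<omega> - W (T l) \<omega>" for l \<omega>
  define V where "V j = (\<Prod>i\<in>UNIV. T (Suc (j i)) - T (j i))" for j :: "'k \<Rightarrow> nat"
  define P where "P j \<omega> = (\<Prod>i\<in>UNIV. X (j i) \<omega>)" for j :: "'k \<Rightarrow> nat" and \<omega>
  have V0: "0 \<le> V j" for j
    unfolding V_def using T by (intro prod_nonneg) (simp add: strict_mono_less_eq)
  have V_cong: "V j = V j'" if "j \<in> ?I" "j' \<in> ?I" "range j = range j'" for j j'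
  proof -
    have "V j = (\<Prod>l\<in>range j. T (Suc l) - T l)" if "j \<in> ?I" for j
      using that by (simp add: V_def off_diagonal_indices_def prod.reindex)
    with that show ?thesis by simp
  qed
  have P: "integrable M (\<lambda>\<omega>. P j \<omega> * P j' \<omega>)"
      "(\<integral>\<omega>. P j \<omega> * P j' \<omega> \<partial>M) = (if range j = range j' then V j else 0)"
    if "j \<in> ?I" "j' \<in> ?I" for j j'
    using brownian_product_moments [OF W T that] by (simp_all add: P_def X_def V_def)
  have sq: "(step_integral W T N c \<omega>)\<^sup>2 = (\<Sum>j\<in>?I. \<Sum>j'\<in>?I. c j * c j' * (P j \<omega> * P j' \<omega>))" for \<omega>
    unfolding step_integral_def P_def X_def power2_eq_square sum_product
    by (intro sum.cong refl) (simp add: algebra_simps)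
  have int: "integrable M (\<lambda>\<omega>. (step_integral W T N c \<omega>)\<^sup>2)"
    unfolding sq by (intro Bochner_Integration.integrable_sum integrable_mult_right P(1))
  have "(\<integral>\<omega>. (step_integral W T N c \<omega>)\<^sup>2 \<partial>M)
      = (\<Sum>j\<in>?I. \<Sum>j'\<in>?I. c j * c j' * (if range j = range j' then V j else 0))"
    unfolding sq by (simp add: P Bochner_Integration.integral_sum)
  also have "\<dots> \<le> (\<Sum>j\<in>?I. \<Sum>j'\<in>?I. if range j = range j' then (c j)\<^sup>2 * V j / 2 + (c j')\<^sup>2 * V j' / 2 else 0)"
  proof (intro sum_mono)
    fix j j' assume jj: "j \<in> ?I" "j' \<in> ?I"
    have "c j * c j' \<le> (c j)\<^sup>2 / 2 + (c j')\<^sup>2 / 2"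
      using sum_squares_bound [of "c j" "c j'"] by simp
    from mult_right_mono [OF this V0 [of j]]
    show "c j * c j' * (if range j = range j' then V j else 0)
        \<le> (if range j = range j' then (c j)\<^sup>2 * V j / 2 + (c j')\<^sup>2 * V j' / 2 else 0)"
      using V_cong [OF jj] by (auto simp: algebra_simps)
  qed
  also have "\<dots> = (\<Sum>j\<in>?I. \<Sum>j'\<in>?I. if range j = range j' then (c j)\<^sup>2 * V j / 2 else 0)
      + (\<Sum>j\<in>?I. \<Sum>j'\<in>?I. if range j = range j' then (c j')\<^sup>2 * V j' / 2 else 0)"
    by (simp add: sum.distrib [symmetric] if_distrib cong: if_cong)
  also have "\<dots> = (\<Sum>j\<in>?I. real (card {j' \<in> ?I. range j' = range j}) * ((c j)\<^sup>2 * V j))"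
  proof -
    \<comment> \<open>Exchanging the order of summation shows that both halves are equal.\<close>
    have "(\<Sum>j\<in>?I. \<Sum>j'\<in>?I. if range j = range j' then (c j')\<^sup>2 * V j' / 2 else 0)
        = (\<Sum>j\<in>?I. \<Sum>j'\<in>?I. if range j = range j' then (c j)\<^sup>2 * V j / 2 else 0)"
      by (subst sum.swap) (intro sum.cong refl, auto)
    moreover have "(\<Sum>j\<in>?I. \<Sum>j'\<in>?I. if range j = range j' then (c j)\<^sup>2 * V j / 2 else 0)
        = (\<Sum>j\<in>?I. real (card {j' \<in> ?I. range j' = range j}) * ((c j)\<^sup>2 * V j / 2))"
      by (intro sum.cong refl) (simp add: sum.If_cases Int_def eq_commute)
    ultimately show ?thesis
      by (simp add: sum.distrib [symmetric] mult_ac)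
  qed
  also have "\<dots> \<le> (\<Sum>j\<in>?I. real (CARD('k) ^ CARD('k)) * ((c j)\<^sup>2 * V j))"
    using card_same_range_le V0 by (intro sum_mono mult_right_mono of_nat_mono) auto
  also have "\<dots> = real (CARD('k) ^ CARD('k)) * (\<Sum>j\<in>?I. (c j)\<^sup>2 * V j)"
    by (simp add: sum_distrib_left)
  finally have "ennreal (\<integral>\<omega>. (step_integral W T N c \<omega>)\<^sup>2 \<partial>M)
      \<le> ennreal (real (CARD('k) ^ CARD('k)) * (\<Sum>j\<in>?I. (c j)\<^sup>2 * V j))"
    by (rule ennreal_leI)
  also have "\<dots> = of_nat (CARD('k) ^ CARD('k)) * (\<integral>\<^sup>+x. ennreal ((step_function T N c x)\<^sup>2) \<partial>lebesgue)"
    unfolding nn_integral_step_function_power2 [OF T] V_def [symmetric]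
    using V0 by (subst ennreal_mult) (auto simp: ennreal_of_nat_eq_real_of_nat intro!: sum_nonneg)
  finally show ?thesis
    using nn_integral_eq_integral [OF int] by simp
qed

text \<open>Over a common grid the difference of two step functions is again one. The estimate also
  shows that the integral depends, up to null sets, on the function alone and not on the grid and
  coefficients that represent it.\<close>

corollary step_integral_sqdist_le:
  fixes c c' :: "('k::finite \<Rightarrow> nat) \<Rightarrow> real"
  assumes W: "brownian_motion M W" and t: "strict_mono t" "strict_mono t'"
  shows "L2_sqdist M (step_integral W t n c) (step_integral W t' n' c')
    \<le> of_nat (CARD('k) ^ CARD('k)) * L2_sqdist lebesgue (step_function t n c) (step_function t' n' c')"
proof -
  obtain T N d where T: "strict_mono T"
    and d: "\<And>i f. i \<in> UNIV \<Longrightarrow> grid_sum (if i then t else t') (if i then n else n') (if i then c else c') f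
      = grid_sum T N (d i) f"
    by (rule common_refinement [of "UNIV :: bool set" "\<lambda>i. if i then t else t'"
          "\<lambda>i. if i then n else n'" "\<lambda>i. if i then c else c'"]) (use t in auto)
  have "grid_sum t n c f = grid_sum T N (d True) f" "grid_sum t' n' c' f = grid_sum T N (d False) f" for f
    using d [of True] d [of False] by simp_all
  then have "step_integral W t n c \<omega> - step_integral W t' n' c' \<omega> = step_integral W T N (\<lambda>j. d True j - d False j) \<omega>"
    "step_function t n c x - step_function t' n' c' x = step_function T N (\<lambda>j. d True j - d False j) x" for \<omega> x
    using t T by (simp_all add: step_integral_eq_grid_sum step_function_eq_grid_sum grid_sum_diff)
  then show ?thesis
    using step_integral_L2_bound [OF W T] by simp
qed

text \<open>Both vectors have independent coordinates, so their laws are the products of the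
  marginals. These agree because stretching an interval by \<open>a\<close> multiplies the standard
  deviation of the normal increment by \<open>sqrt a\<close>.\<close>

lemma distr_increments_affine:
  assumes W: "brownian_motion M W" and T: "strict_mono T" and a: "a > 0"
  shows "distr M (Pi\<^sub>M {..<N} (\<lambda>_. borel)) (\<lambda>\<omega>. \<lambda>l\<in>{..<N}. W (a * T (Suc l) + b) \<omega> - W (a * T l + b) \<omega>)
    = distr M (Pi\<^sub>M {..<N} (\<lambda>_. borel)) (\<lambda>\<omega>. \<lambda>l\<in>{..<N}. sqrt a * (W (T (Suc l)) \<omega> - W (T l) \<omega>))"
proof (cases "N = 0")
  case False
  interpret prob_space M by (rule brownian_motion_prob_space [OF W])
  have [measurable]: "W r \<in> borel_measurable M" for r
    by (rule brownian_motion_measurable [OF W])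
  define S where "S l = a * T l + b" for l
  have S: "strict_mono S"
    using T a by (auto simp: S_def strict_mono_def)
  have lt: "T l < T (Suc l)" "S l < S (Suc l)" for l
    using strict_monoD [OF T, of l "Suc l"] strict_monoD [OF S, of l "Suc l"] by auto
  have indep: "indep_vars (\<lambda>_. borel) (\<lambda>l \<omega>. sqrt a * (W (T (Suc l)) \<omega> - W (T l) \<omega>)) {..<N}"
    using indep_vars_compose2 [OF brownian_motion_indep_vars [OF W T], where Y = "\<lambda>l x. sqrt a * x" and N = "\<lambda>_. borel"]
    by simp
  have law: "distr M borel (\<lambda>\<omega>. W (S (Suc l)) \<omega> - W (S l) \<omega>)
      = distr M borel (\<lambda>\<omega>. sqrt a * (W (T (Suc l)) \<omega> - W (T l) \<omega>))" for l
  proof -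
    have "distributed M lborel (\<lambda>\<omega>. 0 + sqrt a * (W (T (Suc l)) \<omega> - W (T l) \<omega>))
        (normal_density (0 + sqrt a * 0) (\<bar>sqrt a\<bar> * sqrt (T (Suc l) - T l)))"
      using a lt by (intro normal_density_affine brownian_motion_distributed [OF W]) auto
    moreover have "\<bar>sqrt a\<bar> * sqrt (T (Suc l) - T l) = sqrt (S (Suc l) - S l)"
      using a by (simp add: S_def real_sqrt_mult [symmetric] right_diff_distrib)
    ultimately have "distr M lborel (\<lambda>\<omega>. sqrt a * (W (T (Suc l)) \<omega> - W (T l) \<omega>))
        = distr M lborel (\<lambda>\<omega>. W (S (Suc l)) \<omega> - W (S l) \<omega>)"
      using brownian_motion_distributed [OF W lt(2), of l] by (simp add: distributed_def)
    then show ?thesis by (simp cong: distr_cong)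
  qed
  have "distr M (Pi\<^sub>M {..<N} (\<lambda>_. borel)) (\<lambda>\<omega>. \<lambda>l\<in>{..<N}. W (S (Suc l)) \<omega> - W (S l) \<omega>)
      = (\<Pi>\<^sub>M l\<in>{..<N}. distr M borel (\<lambda>\<omega>. W (S (Suc l)) \<omega> - W (S l) \<omega>))"
    using False brownian_motion_indep_vars [OF W S]
    by (intro indep_vars_iff_distr_eq_PiM' [THEN iffD1]) auto
  also have "\<dots> = distr M (Pi\<^sub>M {..<N} (\<lambda>_. borel)) (\<lambda>\<omega>. \<lambda>l\<in>{..<N}. sqrt a * (W (T (Suc l)) \<omega> - W (T l) \<omega>))"
    unfolding law using False indep
    by (intro indep_vars_iff_distr_eq_PiM' [THEN iffD1, symmetric]) auto
  finally show ?thesis by (simp add: S_def)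
qed (simp add: restrict_def)

text \<open>Both vectors are images of increment vectors under one and the same map
  \<open>\<Phi>\<close>. Its homogeneity of degree \<open>CARD('k)\<close> in the increments turns
  \<open>sqrt a\<close> into \<open>sqrt a ^ CARD('k)\<close>.\<close>

lemma distr_step_integrals_affine:
  fixes c :: "'i \<Rightarrow> ('k::finite \<Rightarrow> nat) \<Rightarrow> real"
  assumes W: "brownian_motion M W" and T: "strict_mono T" and a: "a > 0"
  shows "distr M (Pi\<^sub>M J (\<lambda>_. borel)) (\<lambda>\<omega>. \<lambda>i\<in>J. d * step_integral W (\<lambda>l. a * T l + b) N (c i) \<omega>)
    = distr M (Pi\<^sub>M J (\<lambda>_. borel)) (\<lambda>\<omega>. \<lambda>i\<in>J. d * sqrt a ^ CARD('k) * step_integral W T N (c i) \<omega>)"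
proof -
  have [measurable]: "W r \<in> borel_measurable M" for r
    by (rule brownian_motion_measurable [OF W])
  define \<Phi> where "\<Phi> v = (\<lambda>i\<in>J. d * (\<Sum>j\<in>off_diagonal_indices N. c i j * (\<Prod>p\<in>UNIV. v (j p))))"
    for v :: "nat \<Rightarrow> real"
  have j: "j p \<in> {..<N}" if "j \<in> off_diagonal_indices N" for j :: "'k \<Rightarrow> nat" and p
    using that by (auto simp: off_diagonal_indices_def)
  have [measurable]: "\<Phi> \<in> Pi\<^sub>M {..<N} (\<lambda>_. borel) \<rightarrow>\<^sub>M Pi\<^sub>M J (\<lambda>_. borel)"
    unfolding \<Phi>_def
    by (intro measurable_restrict borel_measurable_times borel_measurable_const borel_measurable_sum
        borel_measurable_prod measurable_component_singleton j)
  have "(\<lambda>\<omega>. \<lambda>i\<in>J. d * step_integral W (\<lambda>l. a * T l + b) N (c i) \<omega>)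
      = \<Phi> \<circ> (\<lambda>\<omega>. \<lambda>l\<in>{..<N}. W (a * T (Suc l) + b) \<omega> - W (a * T l + b) \<omega>)"
    using j by (auto simp: \<Phi>_def step_integral_def fun_eq_iff intro!: sum.cong)
  moreover have "(\<lambda>\<omega>. \<lambda>i\<in>J. d * sqrt a ^ CARD('k) * step_integral W T N (c i) \<omega>)
      = \<Phi> \<circ> (\<lambda>\<omega>. \<lambda>l\<in>{..<N}. sqrt a * (W (T (Suc l)) \<omega> - W (T l) \<omega>))"
    using j by (auto simp: \<Phi>_def step_integral_def fun_eq_iff prod.distrib sum_distrib_left mult_ac
        intro!: sum.cong)
  moreover have "distr M (Pi\<^sub>M J (\<lambda>_. borel)) (\<Phi> \<circ> f)
      = distr (distr M (Pi\<^sub>M {..<N} (\<lambda>_. borel)) f) (Pi\<^sub>M J (\<lambda>_. borel)) \<Phi>"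
    if [measurable]: "f \<in> M \<rightarrow>\<^sub>M Pi\<^sub>M {..<N} (\<lambda>_. borel)" for f
    by (rule distr_distr [symmetric]) measurable
  ultimately show ?thesis
    using distr_increments_affine [OF W T a, of N b] by simp
qed

section \<open>Density of step functions\<close>

lemma lebesgue_scaleR_affine_measurable:
  fixes t :: "'a::euclidean_space"
  assumes "c \<noteq> 0"
  shows "(\<lambda>x. t + c *\<^sub>R x) \<in> lebesgue \<rightarrow>\<^sub>M lebesgue"
  using lebesgue_affine_measurable [of "\<lambda>_. c" t] assms
  unfolding scaleR_scaleR [symmetric] scaleR_sum_right [symmetric] euclidean_representation
  by simp

lemma nn_integral_lebesgue_scaleR_affine:
  fixes t :: "'a::euclidean_space"
  assumes c: "c \<noteq> 0" and [measurable]: "f \<in> borel_measurable lebesgue"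
  shows "(\<integral>\<^sup>+x. f x \<partial>lebesgue) = ennreal (\<bar>c\<bar> ^ DIM('a)) * (\<integral>\<^sup>+x. f (t + c *\<^sub>R x) \<partial>lebesgue)"
proof -
  note T [measurable] = lebesgue_scaleR_affine_measurable [OF c, of t]
  have "lebesgue = density (distr lebesgue lebesgue (\<lambda>x. t + c *\<^sub>R x)) (\<lambda>_. ennreal (\<bar>c\<bar> ^ DIM('a)))"
    using lebesgue_affine_euclidean [of "\<lambda>_. c" t] c
    unfolding scaleR_scaleR [symmetric] scaleR_sum_right [symmetric] euclidean_representation prod_constant
    by simp
  then have "(\<integral>\<^sup>+x. f x \<partial>lebesgue)
      = (\<integral>\<^sup>+x. f x \<partial>density (distr lebesgue lebesgue (\<lambda>x. t + c *\<^sub>R x)) (\<lambda>_. ennreal (\<bar>c\<bar> ^ DIM('a))))"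
    by simp
  also have "\<dots> = ennreal (\<bar>c\<bar> ^ DIM('a)) * (\<integral>\<^sup>+x. f (t + c *\<^sub>R x) \<partial>lebesgue)"
    by (subst nn_integral_density) (auto simp: nn_integral_cmult nn_integral_distr)
  finally show ?thesis .
qed

lemma AE_lebesgue_scaleR_affine:
  fixes t :: "'a::euclidean_space"
  assumes c: "c \<noteq> 0" and P: "AE x in lebesgue. P x"
  shows "AE x in lebesgue. P (t + c *\<^sub>R x)"
proof -
  from P obtain N where N: "N \<in> null_sets lebesgue" "{x \<in> space lebesgue. \<not> P x} \<subseteq> N"
    by (auto simp: eventually_ae_filter)
  have [measurable]: "(\<lambda>x. t + c *\<^sub>R x) \<in> lebesgue \<rightarrow>\<^sub>M lebesgue" "N \<in> sets lebesgue"
    using lebesgue_scaleR_affine_measurable [OF c] N(1) by auto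
  have "0 = (\<integral>\<^sup>+x. indicator N x \<partial>lebesgue)"
    using N(1) by auto
  also have "\<dots> = ennreal (\<bar>c\<bar> ^ DIM('a)) * (\<integral>\<^sup>+x. indicator N (t + c *\<^sub>R x) \<partial>lebesgue)"
    by (rule nn_integral_lebesgue_scaleR_affine [OF c]) auto
  finally have "(\<integral>\<^sup>+x. indicator N (t + c *\<^sub>R x) \<partial>lebesgue) = 0"
    using c by auto
  then have "AE x in lebesgue. indicator N (t + c *\<^sub>R x) = (0 :: ennreal)"
    by (subst (asm) nn_integral_0_iff_AE) auto
  then show ?thesis
    by eventually_elim (use N(2) in \<open>auto simp: indicator_eq_0_iff\<close>)
qed

text \<open>The diagonals are hyperplanes with normals \<open>axis p 1 - axis q 1\<close>. Their
  being null is what allows off-diagonal step functions to be dense.\<close>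

lemma AE_distinct_coordinates: "AE x :: real ^ 'k::finite in lebesgue. inj (\<lambda>i. x $ i)"
proof -
  have "AE x :: real ^ 'k in lebesgue. p \<noteq> q \<longrightarrow> x $ p \<noteq> x $ q" for p q
  proof (cases "p = q")
    case False
    then have "axis p 1 - axis q 1 \<noteq> (0 :: real ^ 'k)"
      by (metis axis_eq_axis eq_iff_diff_eq_0 zero_neq_one)
    then have "negligible {x :: real ^ 'k. (axis p 1 - axis q 1) \<bullet> x = 0}"
      by (intro negligible_hyperplane) auto
    then have "AE x :: real ^ 'k in lebesgue. x \<notin> {x. (axis p 1 - axis q 1) \<bullet> x = 0}"
      unfolding negligible_iff_null_sets by (rule AE_not_in)
    then show ?thesis
      by eventually_elim (auto simp: inner_diff_right cart_eq_inner_axis inner_commute)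
  qed simp
  then have "AE x :: real ^ 'k in lebesgue. \<forall>p q. p \<noteq> q \<longrightarrow> x $ p \<noteq> x $ q"
    by (simp add: AE_all_countable)
  then show ?thesis
    by eventually_elim (auto simp: inj_def)
qed

section \<open>Approximation by off-diagonal step functions\<close>

definition step_approximable :: "(real ^ 'k::finite \<Rightarrow> real) \<Rightarrow> bool" where
  "step_approximable f \<longleftrightarrow> (\<exists>t n c. (\<forall>m. strict_mono (t m)) \<and>
     tendsto_L2 lebesgue (\<lambda>m. step_function (t m) (n m) (c m)) f)"

lemma step_function_measurable_lebesgue [measurable]: "step_function t n c \<in> borel_measurable lebesgue"
  by (rule measurable_completion) simp

lemma square_integrable_bounded_box:
  fixes r B :: real
  shows "square_integrable lebesgue (\<lambda>x :: real ^ 'k::finite. B * indicator {x. \<forall>i. - r < x $ i \<and> x $ i \<le> r} x)"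
proof (cases "0 \<le> r")
  case True
  let ?Q = "{x :: real ^ 'k. \<forall>i. - r < x $ i \<and> x $ i \<le> r}"
  have Q: "?Q \<in> sets lborel" "emeasure lborel ?Q < \<infinity>"
    using True emeasure_lborel_half_open_box [of "\<lambda>_ :: 'k. - r" "\<lambda>_. r"]
    by (auto simp: ennreal_less_top)
  have "(\<lambda>x. (B * indicator ?Q x)\<^sup>2) = (\<lambda>x. B\<^sup>2 * indicator ?Q x)"
    by (auto simp: fun_eq_iff indicator_def)
  moreover have "integrable lebesgue (\<lambda>x. B\<^sup>2 * indicator ?Q x)"
    using Q by (intro integrable_mult_right integrable_real_indicator) (auto simp: emeasure_completion)
  ultimately show ?thesis
    using Q(1) by (auto simp: square_integrable_def)
next
  case False
  then have "indicator {x :: real ^ 'k. \<forall>i. - r < x $ i \<and> x $ i \<le> r} = (\<lambda>_. 0 :: real)"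
    by (fastforce simp: indicator_def)
  then show ?thesis by (simp add: square_integrable_def)
qed

text \<open>\<open>\<phi>\<close> is sampled at the lower corners of the cells. Cells with a
  repeated index are left out, but a point with distinct coordinates lies in none of them once the
  mesh is small enough, so there is convergence almost everywhere, dominated by \<open>B\<close> on
  the box.\<close>

lemma step_approximable_continuous:
  fixes \<phi> :: "real ^ 'k::finite \<Rightarrow> real"
  assumes cont: "continuous_on UNIV \<phi>" and B: "\<And>x. \<bar>\<phi> x\<bar> \<le> B"
  shows "step_approximable (\<lambda>x. indicator {x. \<forall>i. - real R < x $ i \<and> x $ i \<le> real R} x * \<phi> x)"
proof -
  let ?Q = "{x :: real ^ 'k. \<forall>i. - real R < x $ i \<and> x $ i \<le> real R}"
  define t where "t m l = - real R + real l / real (Suc m)" for m l :: nat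
  \<comment> \<open>The box has side 2 R and the mesh is 1 / (m + 1), so exactly this many intervals
    tile each side.\<close>
  define n where "n m = 2 * R * Suc m" for m
  define c where "c m j = \<phi> (\<chi> i. t m (j i))" for m and j :: "'k \<Rightarrow> nat"
  let ?F = "\<lambda>m. step_function (t m) (n m) (c m)"
  have t: "strict_mono (t m)" for m
    by (auto simp: strict_mono_def t_def divide_strict_right_mono)
  have cell_sub: "x \<in> ?Q"
    if "j \<in> off_diagonal_indices (n m)" "\<forall>i. t m (j i) < x $ i \<and> x $ i \<le> t m (Suc (j i))" for m j x
  proof -
    have "- real R < x $ i \<and> x $ i \<le> real R" for i
    proof -
      have "Suc (j i) \<le> 2 * R * Suc m"
        using that(1) by (auto simp: off_diagonal_indices_def n_def Suc_le_eq)
      then have "real (Suc (j i)) \<le> real (2 * R * Suc m)"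
        by (rule of_nat_mono)
      then have "real (Suc (j i)) / real (Suc m) \<le> 2 * real R"
        by (simp add: field_simps)
      then have "t m (Suc (j i)) \<le> real R" "- real R \<le> t m (j i)"
        by (auto simp: t_def)
      with that(2) [rule_format, of i] show ?thesis by linarith
    qed
    then show ?thesis by simp
  qed
  have bound: "\<bar>?F m x\<bar> \<le> \<bar>B * indicator ?Q x\<bar>" for m x
  proof (cases "\<exists>j\<in>off_diagonal_indices (n m). \<forall>i. t m (j i) < x $ i \<and> x $ i \<le> t m (Suc (j i))")
    case True
    then obtain j where j: "j \<in> off_diagonal_indices (n m)"
        "\<And>i. t m (j i) < x $ i \<and> x $ i \<le> t m (Suc (j i))"
      by blast
    then have "\<bar>?F m x\<bar> \<le> B"
      using B by (subst step_function_on_cell [OF t j]) (simp add: c_def)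
    with cell_sub [of j m x] j show ?thesis by (auto simp: indicator_def)
  next
    case False
    then have "?F m x = 0"
      by (intro step_function_off_cells) blast
    then show ?thesis by simp
  qed
  have lim: "(\<lambda>m. ?F m x) \<longlonglongrightarrow> indicator ?Q x * \<phi> x" if inj: "inj (\<lambda>i. x $ i)" for x
  proof (cases "x \<in> ?Q")
    case False
    then have ind: "indicator ?Q x = (0 :: real)"
      by (rule indicator_simps)
    have "?F m x = 0" for m
      using bound [of m x] unfolding ind by simp
    with ind show ?thesis by simp
  next
    case True
    define y where "y m i = (x $ i + real R) * real (Suc m)" for m i
    \<comment> \<open>Cells are open on the left and closed on the right, so the interval containing
      the point has index ceiling minus one, not the floor.\<close>
    define k where "k m i = nat (\<lceil>y m i\<rceil> - 1)" for m i
    have y: "0 < y m i" "y m i \<le> real (n m)" for m i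
    proof -
      have x: "0 < x $ i + real R" "x $ i + real R \<le> 2 * real R" using True [THEN CollectD, rule_format, of i] by linarith+
      show "0 < y m i" unfolding y_def using x(1) by simp
      show "y m i \<le> real (n m)"
        using mult_right_mono [OF x(2), of "real (Suc m)"] by (simp add: y_def n_def algebra_simps)
    qed
    have k: "real (k m i) < y m i" "y m i \<le> real (Suc (k m i))" for m i
    proof -
      have "0 < \<lceil>y m i\<rceil>" using y(1) [of m i] by simp
      then have "real (k m i) = of_int \<lceil>y m i\<rceil> - 1" by (simp add: k_def)
      then show "real (k m i) < y m i" "y m i \<le> real (Suc (k m i))"
        using ceiling_correct [of "y m i"] by linarith+
    qed
    have kn: "k m i < n m" for m i
      using k(1) [of m i] y(2) [of m i] by linarith
    have cell: "t m (k m i) < x $ i" "x $ i \<le> t m (Suc (k m i))" for m i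
      using k [of m i] by (simp_all add: t_def y_def field_simps)
    have mesh: "t m (Suc (k m i)) = t m (k m i) + inverse (real (Suc m))" for m i
      by (simp add: t_def field_simps)
    have near: "\<bar>t m (k m i) - x $ i\<bar> \<le> inverse (real (Suc m))" for m i
      using cell [where m = m and i = i] mesh [of m i] by linarith
    have tk: "(\<lambda>m. t m (k m i)) \<longlonglongrightarrow> x $ i" for i
    proof (rule LIM_zero_cancel, rule Lim_null_comparison)
      show "\<forall>\<^sub>F m in sequentially. norm (t m (k m i) - x $ i) \<le> inverse (real (Suc m))"
        using near by simp
    qed (rule LIMSEQ_inverse_real_of_nat)
    then have "(\<lambda>m. \<chi> i. t m (k m i)) \<longlonglongrightarrow> x"
      by (intro vec_tendstoI) simp
    then have c_lim: "(\<lambda>m. c m (k m)) \<longlonglongrightarrow> \<phi> x"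
      unfolding c_def using cont
      by (intro isCont_tendsto_compose [where g = \<phi>]) (auto simp: continuous_on_eq_continuous_at)
    have ev: "\<forall>\<^sub>F m in sequentially. inj (k m)"
    proof -
      have "\<forall>\<^sub>F m in sequentially. k m p = k m q \<longrightarrow> p = q" for p q
      proof (cases "p = q")
        case False
        then have "x $ p \<noteq> x $ q" using inj by (auto simp: inj_def)
        then have "\<forall>\<^sub>F m in sequentially. inverse (real (Suc m)) < \<bar>x $ p - x $ q\<bar>"
          using order_tendstoD(2) [OF LIMSEQ_inverse_real_of_nat, of "\<bar>x $ p - x $ q\<bar>"] by simp
        then show ?thesis
        proof eventually_elim
          fix m assume m: "inverse (real (Suc m)) < \<bar>x $ p - x $ q\<bar>"
          have "\<bar>x $ p - x $ q\<bar> < inverse (real (Suc m))" if "k m p = k m q"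
            using cell [where m = m and i = p] cell [where m = m and i = q] mesh [of m p] that by simp
          with m show "k m p = k m q \<longrightarrow> p = q" by force
        qed
      qed simp
      then have "\<forall>\<^sub>F m in sequentially. \<forall>p q. k m p = k m q \<longrightarrow> p = q"
        by (intro eventually_all_finite)
      then show ?thesis by eventually_elim (auto simp: inj_def)
    qed
    have "\<forall>\<^sub>F m in sequentially. c m (k m) = ?F m x"
      using ev
    proof eventually_elim
      fix m assume "inj (k m)"
      then have "k m \<in> off_diagonal_indices (n m)"
        using kn by (simp add: off_diagonal_indices_def)
      then show "c m (k m) = ?F m x"
        using cell by (intro step_function_on_cell [OF t, symmetric]) auto
    qed
    with c_lim have "(\<lambda>m. ?F m x) \<longlonglongrightarrow> \<phi> x"
      by (rule Lim_transform_eventually)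
    with True show ?thesis by simp
  qed
  have [measurable]: "\<phi> \<in> borel_measurable borel"
    by (rule borel_measurable_continuous_onI [OF cont])
  have "tendsto_L2 lebesgue ?F (\<lambda>x. indicator ?Q x * \<phi> x)"
  proof (rule tendsto_L2_dominated [where w = "\<lambda>x. B * indicator ?Q x"])
    have "(\<lambda>x. indicator ?Q x * \<phi> x) \<in> borel_measurable borel"
      by measurable
    then show "(\<lambda>x. indicator ?Q x * \<phi> x) \<in> borel_measurable lebesgue"
      by (intro measurable_completion) simp
    show "square_integrable lebesgue (\<lambda>x. B * indicator ?Q x)"
      by (rule square_integrable_bounded_box)
    show "AE x in lebesgue. \<bar>indicator ?Q x * \<phi> x\<bar> \<le> \<bar>B * indicator ?Q x\<bar>"
      using B order_trans [OF B abs_ge_self] by (auto simp: indicator_def)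
    show "AE x in lebesgue. (\<lambda>m. ?F m x) \<longlonglongrightarrow> indicator ?Q x * \<phi> x"
      using AE_distinct_coordinates by eventually_elim (rule lim)
  qed (use bound in auto)
  with t show ?thesis
    unfolding step_approximable_def by blast
qed

lemma step_approximable_limit:
  assumes f: "\<And>m. step_approximable (f m)" and lim: "tendsto_L2 lebesgue f g"
    and [measurable]: "\<And>m. f m \<in> borel_measurable lebesgue" "g \<in> borel_measurable lebesgue"
  shows "step_approximable g"
proof -
  have "\<exists>t n c. strict_mono t \<and> L2_sqdist lebesgue (step_function t n c) g \<le> ennreal (inverse (real (Suc m)))" for m
  proof -
    \<comment> \<open>A quarter, because the triangle inequality for squared distances doubles both
      errors.\<close>
    define e where "e = ennreal (inverse (real (Suc m)) / 4)"
    have "0 < e" by (simp add: e_def)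
    then obtain m' where m': "L2_sqdist lebesgue (f m') g < e"
      using order_tendstoD(2) [OF lim [unfolded tendsto_L2_def]] by (auto simp: eventually_sequentially)
    obtain t n c where t: "\<And>l. strict_mono (t l)"
      and tl: "tendsto_L2 lebesgue (\<lambda>l. step_function (t l) (n l) (c l)) (f m')"
      using f [of m'] unfolding step_approximable_def by blast
    obtain l where l: "L2_sqdist lebesgue (step_function (t l) (n l) (c l)) (f m') < e"
      using order_tendstoD(2) [OF tl [unfolded tendsto_L2_def] \<open>0 < e\<close>]
      by (auto simp: eventually_sequentially)
    have "L2_sqdist lebesgue (step_function (t l) (n l) (c l)) g
        \<le> 2 * L2_sqdist lebesgue (step_function (t l) (n l) (c l)) (f m') + 2 * L2_sqdist lebesgue (f m') g"
      by (rule L2_sqdist_triangle) auto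
    also have "\<dots> \<le> 2 * e + 2 * e"
      using l m' by (intro add_mono mult_left_mono) auto
    also have "\<dots> = ennreal (inverse (real (Suc m)))"
      unfolding e_def by (simp add: ennreal_mult [symmetric] ennreal_plus [symmetric] flip: ennreal_numeral)
    finally show ?thesis using t by blast
  qed
  then obtain t n c where t: "\<And>m. strict_mono (t m)"
    and le: "\<And>m. L2_sqdist lebesgue (step_function (t m) (n m) (c m)) g \<le> ennreal (inverse (real (Suc m)))"
    by metis
  have "(\<lambda>m. ennreal (inverse (real (Suc m)))) \<longlonglongrightarrow> 0"
    using tendsto_ennrealI [OF LIMSEQ_inverse_real_of_nat] by simp
  from ennreal_tendsto_0_mono [OF le this] t show ?thesis
    unfolding step_approximable_def tendsto_L2_def by blast
qed

text \<open>Truncation to the box \<open>Q R\<close> and to values between -R and R reduces the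
  claim to bounded functions on a box. For these, Lebesgue measurability supplies continuous
  functions converging almost everywhere; clamping them with \<open>cl R\<close> keeps them
  continuous and provides a dominating function.\<close>

theorem square_integrable_step_approximable:
  fixes f :: "real ^ 'k::finite \<Rightarrow> real"
  assumes f: "square_integrable lebesgue f"
  shows "step_approximable f"
proof -
  define Q :: "nat \<Rightarrow> (real ^ 'k) set" where "Q R = {x. \<forall>i. - real R < x $ i \<and> x $ i \<le> real R}" for R
  define cl where "cl R y = max (- real R) (min (real R) y)" for R y
  have [measurable]: "f \<in> borel_measurable lebesgue"
    using f by auto
  have "Q R \<in> sets borel" for R
    unfolding Q_def by measurable
  then have [measurable]: "Q R \<in> sets lebesgue" for R by simp
  have cl: "\<bar>cl R y\<bar> \<le> real R" "\<bar>cl R y\<bar> \<le> \<bar>y\<bar>" for R y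
    by (auto simp: cl_def)
  have [measurable]: "(\<lambda>x. indicator (Q R) x * cl R (f x)) \<in> borel_measurable lebesgue" for R
    unfolding cl_def by measurable
  have "step_approximable (\<lambda>x. indicator (Q R) x * cl R (f x))" for R
  proof -
    have "f measurable_on UNIV"
      by (rule lebesgue_measurable_imp_measurable_on) auto
    then obtain K g where K: "negligible K" and g: "\<And>n. continuous_on UNIV (g n)"
      and lim: "\<And>x. x \<notin> K \<Longrightarrow> (\<lambda>n. g n x) \<longlonglongrightarrow> f x"
      unfolding measurable_on_def by auto
    have cont: "continuous_on UNIV (\<lambda>x. cl R (g n x))" for n
      unfolding cl_def by (intro continuous_intros g)
    have approx: "step_approximable (\<lambda>x. indicator (Q R) x * cl R (g n x))" for n
      unfolding Q_def by (rule step_approximable_continuous [OF cont cl(1)])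
    have [measurable]: "g n \<in> borel_measurable lebesgue" for n
      by (rule measurable_completion) (use borel_measurable_continuous_onI [OF g] in simp)
    show ?thesis
    proof (rule step_approximable_limit [OF approx])
      show "(\<lambda>x. indicator (Q R) x * cl R (g n x)) \<in> borel_measurable lebesgue" for n
        unfolding cl_def by measurable
      show "tendsto_L2 lebesgue (\<lambda>n x. indicator (Q R) x * cl R (g n x)) (\<lambda>x. indicator (Q R) x * cl R (f x))"
      proof (rule tendsto_L2_dominated [where w = "\<lambda>x. real R * indicator (Q R) x"])
        show "square_integrable lebesgue (\<lambda>x. real R * indicator (Q R) x)"
          unfolding Q_def by (rule square_integrable_bounded_box)
        have "AE x in lebesgue. x \<notin> K"
          using K by (simp add: negligible_iff_null_sets AE_not_in)
        then show "AE x in lebesgue. (\<lambda>n. indicator (Q R) x * cl R (g n x)) \<longlonglongrightarrow> indicator (Q R) x * cl R (f x)"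
          by eventually_elim (auto simp: cl_def intro!: tendsto_intros lim)
        show "(\<lambda>x. indicator (Q R) x * cl R (g n x)) \<in> borel_measurable lebesgue" for n
          unfolding cl_def by measurable
        show "(\<lambda>x. indicator (Q R) x * cl R (f x)) \<in> borel_measurable lebesgue"
          by measurable
      qed (use cl(1) in \<open>auto simp: indicator_def\<close>)
    qed auto
  qed
  moreover have "tendsto_L2 lebesgue (\<lambda>R x. indicator (Q R) x * cl R (f x)) f"
  proof (rule tendsto_L2_dominated [OF _ _ f])
    show "AE x in lebesgue. (\<lambda>R. indicator (Q R) x * cl R (f x)) \<longlonglongrightarrow> f x"
    proof (intro AE_I2 tendsto_eventually)
      fix x
      obtain N where N: "\<bar>f x\<bar> + (\<Sum>i\<in>UNIV. \<bar>x $ i\<bar>) < real N"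
        using reals_Archimedean2 by blast
      show "\<forall>\<^sub>F R in sequentially. indicator (Q R) x * cl R (f x) = f x"
        unfolding eventually_sequentially
      proof (intro exI allI impI)
        fix R assume R: "N \<le> R"
        have "\<bar>x $ i\<bar> \<le> (\<Sum>i\<in>UNIV. \<bar>x $ i\<bar>)" for i
          by (intro member_le_sum) auto
        moreover have "0 \<le> (\<Sum>i\<in>UNIV. \<bar>x $ i\<bar>)" "real N \<le> real R"
          using R by (auto intro: sum_nonneg)
        ultimately have "\<bar>x $ i\<bar> < real R \<and> \<bar>f x\<bar> < real R" for i
          using N by (smt (verit))
        then have "x \<in> Q R" "cl R (f x) = f x"
          by (auto simp: Q_def cl_def abs_less_iff less_imp_le minus_less_iff)
        then show "indicator (Q R) x * cl R (f x) = f x" by simp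
      qed
    qed
    show "AE x in lebesgue. \<bar>indicator (Q R) x * cl R (f x)\<bar> \<le> \<bar>f x\<bar>" for R
      using cl(2) by (auto simp: indicator_def)
  qed auto
  ultimately show ?thesis
    by (rule step_approximable_limit) auto
qed

section \<open>Multiple Wiener-Ito integrals\<close>

proposition has_wiener_ito_integral_exists:
  fixes f :: "real ^ 'k::finite \<Rightarrow> real"
  assumes W: "brownian_motion M W" and f: "square_integrable lebesgue f"
  shows "\<exists>Y. has_wiener_ito_integral M W f Y"
proof -
  have [measurable]: "f \<in> borel_measurable lebesgue" using f by auto
  obtain t n c where t: "\<And>m. strict_mono (t m)"
    and tl: "tendsto_L2 lebesgue (\<lambda>m. step_function (t m) (n m) (c m)) f"
    using square_integrable_step_approximable [OF f] unfolding step_approximable_def by blast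
  let ?F = "\<lambda>m. step_function (t m) (n m) (c m)" and ?I = "\<lambda>m. step_integral W (t m) (n m) (c m)"
  define K where "K = real (CARD('k) ^ CARD('k))"
  have K: "0 < K" by (simp add: K_def)
  have le: "L2_sqdist M (?I m) (?I m') \<le> ennreal K * L2_sqdist lebesgue (?F m) (?F m')" for m m'
    using step_integral_sqdist_le [OF W t t] by (simp only: K_def ennreal_of_nat_eq_real_of_nat)
  have "square_integrable M (?I m)" for m
  proof -
    have "(\<integral>\<^sup>+\<omega>. ennreal ((?I m \<omega>)\<^sup>2) \<partial>M)
        \<le> of_nat (CARD('k) ^ CARD('k)) * (\<integral>\<^sup>+x. ennreal ((?F m x)\<^sup>2) \<partial>lebesgue)"
      by (rule step_integral_L2_bound [OF W t])
    also have "\<dots> < \<infinity>"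
      by (simp add: nn_integral_step_function_power2 [OF t] ennreal_mult_less_top
          ennreal_of_nat_eq_real_of_nat del: of_nat_power)
    finally show ?thesis
      by (simp add: square_integrable_iff_nn_integral step_integral_measurable [OF W])
  qed
  moreover have "\<exists>N. \<forall>m\<ge>N. \<forall>m'\<ge>N. L2_sqdist M (?I m) (?I m') \<le> ennreal e" if "e > 0" for e
  proof -
    \<comment> \<open>Two errors, each doubled by the triangle inequality and enlarged by
      \<open>K\<close>, then add up to \<open>e\<close>.\<close>
    define d where "d = ennreal (e / (4 * K))"
    have "0 < d" using that K by (simp add: d_def)
    then obtain N where N: "\<And>m. m \<ge> N \<Longrightarrow> L2_sqdist lebesgue (?F m) f < d"
      using order_tendstoD(2) [OF tl [unfolded tendsto_L2_def]] by (auto simp: eventually_sequentially)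
    have "L2_sqdist M (?I m) (?I m') \<le> ennreal e" if "m \<ge> N" "m' \<ge> N" for m m'
    proof -
      have "L2_sqdist lebesgue (?F m) (?F m') \<le> 2 * L2_sqdist lebesgue (?F m) f + 2 * L2_sqdist lebesgue f (?F m')"
        by (rule L2_sqdist_triangle) auto
      also have "\<dots> \<le> 2 * d + 2 * d"
        using N [OF that(1)] N [OF that(2)] L2_sqdist_commute [of lebesgue f "?F m'"]
        by (intro add_mono mult_left_mono) auto
      finally have "ennreal K * L2_sqdist lebesgue (?F m) (?F m') \<le> ennreal K * (2 * d + 2 * d)"
        by (intro mult_left_mono) auto
      also have "2 * d + 2 * d = ennreal (e / K)"
        using K \<open>e > 0\<close> unfolding d_def
        by (simp add: ennreal_mult [symmetric] ennreal_plus [symmetric] flip: ennreal_numeral)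
      also have "ennreal K * ennreal (e / K) = ennreal e"
        using K \<open>e > 0\<close> by (simp add: ennreal_mult [symmetric])
      finally show ?thesis using le [of m m'] by (rule order_trans [rotated])
    qed
    then show ?thesis by blast
  qed
  ultimately obtain Y where "square_integrable M Y" "tendsto_L2 M ?I Y"
    by (rule L2_complete)
  with f t tl show ?thesis
    unfolding has_wiener_ito_integral_def by blast
qed

lemma has_wiener_ito_integral_wiener_ito_integral:
  assumes "brownian_motion M W" "square_integrable lebesgue f"
  shows "has_wiener_ito_integral M W f (wiener_ito_integral M W f)"
  unfolding wiener_ito_integral_def
  by (rule someI_ex [OF has_wiener_ito_integral_exists [OF assms]])

text \<open>\<open>has_wiener_ito_integral\<close> asserts only that some approximating sequence
  works; by the mean-square bound every one does. This gives access to a value picked by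
  \<open>SOME\<close>, and it contains the uniqueness of the integral up to null sets.\<close>

lemma has_wiener_ito_integral_tendsto:
  assumes W: "brownian_motion M W" and Y: "has_wiener_ito_integral M W f Y"
    and t: "\<And>m. strict_mono (t m)" and lim: "tendsto_L2 lebesgue (\<lambda>m. step_function (t m) (n m) (c m)) f"
  shows "tendsto_L2 M (\<lambda>m. step_integral W (t m) (n m) (c m)) Y"
proof -
  let ?F = "\<lambda>m. step_function (t m) (n m) (c m)"
  obtain t' n' c' where t': "\<And>m. strict_mono (t' m)"
    and F: "tendsto_L2 lebesgue (\<lambda>m. step_function (t' m) (n' m) (c' m)) f"
    and I: "tendsto_L2 M (\<lambda>m. step_integral W (t' m) (n' m) (c' m)) Y"
    and [measurable]: "f \<in> borel_measurable lebesgue" "Y \<in> borel_measurable M"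
    using Y unfolding has_wiener_ito_integral_def by auto
  let ?F' = "\<lambda>m. step_function (t' m) (n' m) (c' m)"
  have [measurable]: "step_integral W t n c \<in> borel_measurable M" for t n and c :: "('b \<Rightarrow> nat) \<Rightarrow> real"
    by (rule step_integral_measurable [OF W])
  have "(\<lambda>m. of_nat (CARD('b) ^ CARD('b)) * (2 * L2_sqdist lebesgue (?F m) f + 2 * L2_sqdist lebesgue f (?F' m)))
      \<longlonglongrightarrow> of_nat (CARD('b) ^ CARD('b)) * (2 * 0 + 2 * 0)"
    using lim F L2_sqdist_commute [of lebesgue f] unfolding tendsto_L2_def
    by (intro ennreal_tendsto_cmult tendsto_add) (auto simp: less_top [symmetric] ennreal_of_nat_eq_real_of_nat simp del: of_nat_power)
  then have lim0: "(\<lambda>m. of_nat (CARD('b) ^ CARD('b)) * (2 * L2_sqdist lebesgue (?F m) f + 2 * L2_sqdist lebesgue f (?F' m)))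
      \<longlonglongrightarrow> 0"
    by (simp only: mult_zero_right add_0_left)
  have bound: "L2_sqdist M (step_integral W (t m) (n m) (c m)) (step_integral W (t' m) (n' m) (c' m))
      \<le> of_nat (CARD('b) ^ CARD('b)) * (2 * L2_sqdist lebesgue (?F m) f + 2 * L2_sqdist lebesgue f (?F' m))" for m
    by (rule order_trans [OF step_integral_sqdist_le [OF W t t']])
       (intro mult_left_mono L2_sqdist_triangle; simp)
  show ?thesis
    by (rule tendsto_L2_trans [OF I ennreal_tendsto_0_mono [OF bound lim0]]) auto
qed

text \<open>Linearity as far as the increments of the process need it. Differences of step functions
  are step functions after passage to a common grid, chosen separately for each term of the
  approximating sequences.\<close>

lemma has_wiener_ito_integral_diff:
  fixes f g :: "real ^ 'k::finite \<Rightarrow> real"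
  assumes W: "brownian_motion M W"
    and f: "has_wiener_ito_integral M W f Y" and g: "has_wiener_ito_integral M W g Z"
  shows "has_wiener_ito_integral M W (\<lambda>x. f x - g x) (\<lambda>\<omega>. Y \<omega> - Z \<omega>)"
proof -
  obtain t n c where t: "\<And>m. strict_mono (t m)"
    and F: "tendsto_L2 lebesgue (\<lambda>m. step_function (t m) (n m) (c m)) f"
    and Y: "tendsto_L2 M (\<lambda>m. step_integral W (t m) (n m) (c m)) Y"
    and fY: "square_integrable lebesgue f" "square_integrable M Y"
    using f unfolding has_wiener_ito_integral_def by auto
  obtain t' n' c' where t': "\<And>m. strict_mono (t' m)"
    and G: "tendsto_L2 lebesgue (\<lambda>m. step_function (t' m) (n' m) (c' m)) g"
    and Z: "tendsto_L2 M (\<lambda>m. step_integral W (t' m) (n' m) (c' m)) Z"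
    and gZ: "square_integrable lebesgue g" "square_integrable M Z"
    using g unfolding has_wiener_ito_integral_def by auto
  have "\<exists>T N d. strict_mono T \<and>
      (\<forall>x. step_function (t m) (n m) (c m) x - step_function (t' m) (n' m) (c' m) x = step_function T N d x) \<and>
      (\<forall>\<omega>. step_integral W (t m) (n m) (c m) \<omega> - step_integral W (t' m) (n' m) (c' m) \<omega> = step_integral W T N d \<omega>)" for m
  proof -
    obtain T N d where T: "strict_mono T"
      and d: "\<And>i f. i \<in> UNIV \<Longrightarrow> grid_sum (if i then t m else t' m) (if i then n m else n' m) (if i then c m else c' m) f
        = grid_sum T N (d i) f"
      by (rule common_refinement [of "UNIV :: bool set" "\<lambda>i. if i then t m else t' m"
            "\<lambda>i. if i then n m else n' m" "\<lambda>i. if i then c m else c' m"]) (use t t' in auto)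
    have "grid_sum (t m) (n m) (c m) f = grid_sum T N (d True) f"
      "grid_sum (t' m) (n' m) (c' m) f = grid_sum T N (d False) f" for f
      using d [of True] d [of False] by simp_all
    then show ?thesis
      using t t' T
      by (intro exI [of _ T] exI [of _ N] exI [of _ "\<lambda>j. d True j - d False j"])
         (simp add: step_integral_eq_grid_sum step_function_eq_grid_sum grid_sum_diff)
  qed
  then obtain T N d where T: "\<And>m. strict_mono (T m)"
    and dF: "\<And>m x. step_function (t m) (n m) (c m) x - step_function (t' m) (n' m) (c' m) x = step_function (T m) (N m) (d m) x"
    and dI: "\<And>m \<omega>. step_integral W (t m) (n m) (c m) \<omega> - step_integral W (t' m) (n' m) (c' m) \<omega> = step_integral W (T m) (N m) (d m) \<omega>"
    by metis
  have "tendsto_L2 lebesgue (\<lambda>m x. step_function (t m) (n m) (c m) x - step_function (t' m) (n' m) (c' m) x) (\<lambda>x. f x - g x)"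
    using fY gZ by (intro tendsto_L2_diff F G) auto
  moreover have "tendsto_L2 M (\<lambda>m \<omega>. step_integral W (t m) (n m) (c m) \<omega> - step_integral W (t' m) (n' m) (c' m) \<omega>) (\<lambda>\<omega>. Y \<omega> - Z \<omega>)"
    using fY gZ by (intro tendsto_L2_diff Y Z step_integral_measurable [OF W]) auto
  ultimately have "tendsto_L2 lebesgue (\<lambda>m. step_function (T m) (N m) (d m)) (\<lambda>x. f x - g x)"
      "tendsto_L2 M (\<lambda>m. step_integral W (T m) (N m) (d m)) (\<lambda>\<omega>. Y \<omega> - Z \<omega>)"
    unfolding dF dI by simp_all
  with T square_integrable_diff [OF fY(1) gZ(1)] square_integrable_diff [OF fY(2) gZ(2)] show ?thesis
    unfolding has_wiener_ito_integral_def by (intro conjI exI [of _ T] exI [of _ N] exI [of _ d]) auto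
qed

text \<open>The approximations of all \<open>f i\<close> are put on a common grid
  \<open>T m\<close>. Its image under r -> a r + b carries approximations of the
  \<open>f' i\<close>, whose integrals have, for each \<open>m\<close>, the same joint law as the
  rescaled integrals over \<open>T m\<close>; the equality survives the limit.\<close>

theorem wiener_ito_integrals_affine_law:
  fixes f f' :: "'i \<Rightarrow> real ^ 'k::finite \<Rightarrow> real"
  assumes W: "brownian_motion M W" and J: "finite J" and a: "a > 0"
    and Y: "\<And>i. i \<in> J \<Longrightarrow> has_wiener_ito_integral M W (f i) (Y i)"
    and Y': "\<And>i. i \<in> J \<Longrightarrow> has_wiener_ito_integral M W (f' i) (Y' i)"
    and f': "\<And>i. i \<in> J \<Longrightarrow> AE x in lebesgue. f' i (b *\<^sub>R 1 + a *\<^sub>R x) = d * f i x"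
  shows "distr M (Pi\<^sub>M J (\<lambda>_. borel)) (\<lambda>\<omega>. \<lambda>i\<in>J. Y' i \<omega>)
    = distr M (Pi\<^sub>M J (\<lambda>_. borel)) (\<lambda>\<omega>. \<lambda>i\<in>J. d * sqrt a ^ CARD('k) * Y i \<omega>)"
proof -
  interpret prob_space M by (rule brownian_motion_prob_space [OF W])
  have "\<forall>i\<in>J. \<exists>p. (\<forall>m. strict_mono (fst p m)) \<and>
      tendsto_L2 lebesgue (\<lambda>m. step_function (fst p m) (fst (snd p) m) (snd (snd p) m)) (f i) \<and>
      tendsto_L2 M (\<lambda>m. step_integral W (fst p m) (fst (snd p) m) (snd (snd p) m)) (Y i)"
    using Y by (simp add: has_wiener_ito_integral_def)
  from bchoice [OF this] obtain p where p: "\<forall>i\<in>J. (\<forall>m. strict_mono (fst (p i) m)) \<and>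
      tendsto_L2 lebesgue (\<lambda>m. step_function (fst (p i) m) (fst (snd (p i)) m) (snd (snd (p i)) m)) (f i) \<and>
      tendsto_L2 M (\<lambda>m. step_integral W (fst (p i) m) (fst (snd (p i)) m) (snd (snd (p i)) m)) (Y i)"
    by blast
  define t n c where "t i = fst (p i)" and "n i = fst (snd (p i))" and "c i = snd (snd (p i))" for i
  have t: "\<And>i m. i \<in> J \<Longrightarrow> strict_mono (t i m)"
    and F: "\<And>i. i \<in> J \<Longrightarrow> tendsto_L2 lebesgue (\<lambda>m. step_function (t i m) (n i m) (c i m)) (f i)"
    and I: "\<And>i. i \<in> J \<Longrightarrow> tendsto_L2 M (\<lambda>m. step_integral W (t i m) (n i m) (c i m)) (Y i)"
    using p by (simp_all add: t_def n_def c_def)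
  have "\<exists>T N c'. strict_mono T \<and> (\<forall>i\<in>J. \<forall>f. grid_sum (t i m) (n i m) (c i m) f = grid_sum T N (c' i) f)" for m
    by (rule common_refinement [of J "\<lambda>i. t i m" "\<lambda>i. n i m" "\<lambda>i. c i m"]) (use J t in auto)
  then obtain T N c' where T: "\<And>m. strict_mono (T m)"
    and c': "\<And>m i f. i \<in> J \<Longrightarrow> grid_sum (t i m) (n i m) (c i m) f = grid_sum (T m) (N m) (c' m i) f"
    by metis
  have F': "tendsto_L2 lebesgue (\<lambda>m. step_function (T m) (N m) (c' m i)) (f i)" if i: "i \<in> J" for i
  proof -
    have "step_function (t i m) (n i m) (c i m) = step_function (T m) (N m) (c' m i)" for m
      by (rule ext) (simp add: step_function_eq_grid_sum t T i c')
    with F [OF i] show ?thesis by simp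
  qed
  have I': "tendsto_L2 M (\<lambda>m. step_integral W (T m) (N m) (c' m i)) (Y i)" if i: "i \<in> J" for i
  proof -
    have "step_integral W (t i m) (n i m) (c i m) = step_integral W (T m) (N m) (c' m i)" for m
      by (rule ext) (simp add: step_integral_eq_grid_sum i c')
    with I [OF i] show ?thesis by simp
  qed
  define S where "S m l = a * T m l + b" for m l
  have S: "strict_mono (S m)" for m
    using T [of m] a by (auto simp: S_def strict_mono_def)
  \<comment> \<open>The moved cell is the image of the old one under x -> b 1 + a x, so
    \<open>G m i\<close> pulled back along this map is \<open>d\<close> times the original step
    function.\<close>
  define G where "G m i = step_function (S m) (N m) (\<lambda>j. d * c' m i j)" for m i
  have G_eq: "G m i (b *\<^sub>R 1 + a *\<^sub>R x) = d * step_function (T m) (N m) (c' m i) x" for m i x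
  proof -
    have "indicator {S m l<..S m (Suc l)} (b + a * x $ p) = (indicator {T m l<..T m (Suc l)} (x $ p) :: real)" for l p
      using a by (auto simp: S_def indicator_def add.commute)
    then show ?thesis
      by (simp add: G_def step_function_def sum_distrib_left mult.assoc)
  qed
  have G_lim: "tendsto_L2 lebesgue (\<lambda>m. G m i) (f' i)" if i: "i \<in> J" for i
  proof -
    have [measurable]: "f i \<in> borel_measurable lebesgue" "f' i \<in> borel_measurable lebesgue"
      using Y [OF i] Y' [OF i] by (auto simp: has_wiener_ito_integral_def)
    \<comment> \<open>The factor \<open>a ^ CARD('k)\<close> is the Jacobian; it does not depend on
      \<open>m\<close>, so convergence is preserved.\<close>
    have "L2_sqdist lebesgue (G m i) (f' i)
        = ennreal (a ^ CARD('k) * d\<^sup>2) * L2_sqdist lebesgue (step_function (T m) (N m) (c' m i)) (f i)" for m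
    proof -
      have [measurable]: "G m i \<in> borel_measurable lebesgue" by (simp add: G_def)
      have "L2_sqdist lebesgue (G m i) (f' i) = ennreal (\<bar>a\<bar> ^ DIM(real ^ 'k)) *
          (\<integral>\<^sup>+x. ennreal ((G m i (b *\<^sub>R 1 + a *\<^sub>R x) - f' i (b *\<^sub>R 1 + a *\<^sub>R x))\<^sup>2) \<partial>lebesgue)"
        using a by (intro nn_integral_lebesgue_scaleR_affine) auto
      also have "(\<integral>\<^sup>+x. ennreal ((G m i (b *\<^sub>R 1 + a *\<^sub>R x) - f' i (b *\<^sub>R 1 + a *\<^sub>R x))\<^sup>2) \<partial>lebesgue)
          = (\<integral>\<^sup>+x. ennreal (d\<^sup>2) * ennreal ((step_function (T m) (N m) (c' m i) x - f i x)\<^sup>2) \<partial>lebesgue)"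
        using f' [OF i]
        by (intro nn_integral_cong_AE, eventually_elim)
           (simp add: G_eq ennreal_mult [symmetric] power_mult_distrib [symmetric] right_diff_distrib)
      also have "\<dots> = ennreal (d\<^sup>2) * L2_sqdist lebesgue (step_function (T m) (N m) (c' m i)) (f i)"
        by (intro nn_integral_cmult) auto
      finally show ?thesis
        using a by (simp add: ennreal_mult mult.assoc)
    qed
    moreover have "(\<lambda>m. ennreal (a ^ CARD('k) * d\<^sup>2) * L2_sqdist lebesgue (step_function (T m) (N m) (c' m i)) (f i))
        \<longlonglongrightarrow> ennreal (a ^ CARD('k) * d\<^sup>2) * 0"
      using F' [OF i] unfolding tendsto_L2_def by (intro ennreal_tendsto_cmult) auto
    ultimately show ?thesis by (simp add: tendsto_L2_def)
  qed
  have dS: "step_integral W (S m) (N m) (\<lambda>j. d * c' m i j) = (\<lambda>\<omega>. d * step_integral W (S m) (N m) (c' m i) \<omega>)" for m i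
    by (simp add: fun_eq_iff step_integral_eq_grid_sum grid_sum_cmult)
  have YM: "Y i \<in> borel_measurable M" "Y' i \<in> borel_measurable M" if "i \<in> J" for i
    using Y [OF that] Y' [OF that] by (auto simp: has_wiener_ito_integral_def)
  note SM = step_integral_measurable [OF W]
  show ?thesis
  proof (rule distr_eq_of_tendsto_L2 [OF J])
    show "tendsto_L2 M (\<lambda>m \<omega>. d * step_integral W (S m) (N m) (c' m i) \<omega>) (Y' i)" if "i \<in> J" for i
      using has_wiener_ito_integral_tendsto [OF W Y' [OF that] S G_lim [OF that, unfolded G_def]]
      by (simp add: dS)
    show "tendsto_L2 M (\<lambda>m \<omega>. d * sqrt a ^ CARD('k) * step_integral W (T m) (N m) (c' m i) \<omega>)
        (\<lambda>\<omega>. d * sqrt a ^ CARD('k) * Y i \<omega>)" if "i \<in> J" for i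
      by (intro tendsto_L2_cmult I' that SM YM)
    show "distr M (Pi\<^sub>M J (\<lambda>_. borel)) (\<lambda>\<omega>. \<lambda>i\<in>J. d * step_integral W (S m) (N m) (c' m i) \<omega>)
        = distr M (Pi\<^sub>M J (\<lambda>_. borel)) (\<lambda>\<omega>. \<lambda>i\<in>J. d * sqrt a ^ CARD('k) * step_integral W (T m) (N m) (c' m i) \<omega>)" for m
      using distr_step_integrals_affine [OF W T a] unfolding S_def .
  qed (use SM YM in \<open>auto intro!: borel_measurable_times\<close>)
qed

section \<open>The kernels of the process\<close>

text \<open>The values of \<open>g\<close> off the orthant are unspecified. Setting them to 0
  absorbs the condition that all coordinates of x lie below s into the kernel, and makes homogeneity
  hold on the whole space.\<close>

definition zero_extension :: "(real ^ 'k::finite \<Rightarrow> real) \<Rightarrow> real ^ 'k \<Rightarrow> real" where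
  "zero_extension g y = (if y \<in> pos_orthant then g y else 0)"

lemma h_integrand_eq_zero_extension: "h_integrand g x s = zero_extension g (s *\<^sub>R 1 - x)"
  by (simp add: h_integrand_def zero_extension_def pos_orthant_def)

lemma pos_orthant_borel: "pos_orthant \<in> sets borel"
  unfolding pos_orthant_def by measurable

lemma zero_extension_measurable:
  assumes "generalized_Hermite_kernel \<alpha> g"
  shows "zero_extension g \<in> borel_measurable lebesgue"
  unfolding zero_extension_def using assms pos_orthant_borel
  by (intro borel_measurable_if_I) (auto simp: generalized_Hermite_kernel_def)

lemma zero_extension_scale:
  fixes g :: "real ^ 'k::finite \<Rightarrow> real"
  assumes g: "generalized_Hermite_kernel \<alpha> g" and r: "r > 0"
  shows "zero_extension g (r *\<^sub>R y) = r powr \<alpha> * zero_extension g y"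
proof -
  have "r *\<^sub>R y \<in> pos_orthant \<longleftrightarrow> y \<in> pos_orthant"
    using r by (simp add: pos_orthant_def zero_less_mult_iff)
  then show ?thesis
    using g r by (simp add: zero_extension_def generalized_Hermite_kernel_def)
qed

lemma h_integrand_scale:
  assumes "generalized_Hermite_kernel \<alpha> g" "a > 0"
  shows "h_integrand g (a *\<^sub>R x) (a * s) = a powr \<alpha> * h_integrand g x s"
  using zero_extension_scale [OF assms, of "s *\<^sub>R 1 - x"]
  by (simp add: h_integrand_eq_zero_extension scaleR_diff_right)

lemma h_integrand_translate: "h_integrand g (b *\<^sub>R 1 + x) (b + s) = h_integrand g x s"
  by (simp add: h_integrand_eq_zero_extension scaleR_add_left)

text \<open>The absolute autocorrelation of the kernel along the diagonal direction; condition (B)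
  is its finiteness at \<open>r = 1\<close>.\<close>

definition kernel_correlation :: "(real ^ 'k::finite \<Rightarrow> real) \<Rightarrow> real \<Rightarrow> ennreal" where
  "kernel_correlation g r =
     (\<integral>\<^sup>+y. ennreal \<bar>zero_extension g y\<bar> * ennreal \<bar>zero_extension g (y + r *\<^sub>R 1)\<bar> \<partial>lebesgue)"

lemma kernel_correlation_1_finite:
  fixes g :: "real ^ 'k::finite \<Rightarrow> real"
  assumes "generalized_Hermite_kernel \<alpha> g"
  shows "kernel_correlation g 1 < \<infinity>"
proof -
  have "kernel_correlation g 1 = (\<integral>\<^sup>+x\<in>pos_orthant. ennreal \<bar>g x * g (1 + x)\<bar> \<partial>lebesgue)"
    unfolding kernel_correlation_def
  proof (intro nn_integral_cong)
    fix y :: "real ^ 'k"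
    have "y + 1 \<in> pos_orthant" if "y \<in> pos_orthant"
      using that by (auto simp: pos_orthant_def add_pos_pos)
    then show "ennreal \<bar>zero_extension g y\<bar> * ennreal \<bar>zero_extension g (y + 1 *\<^sub>R 1)\<bar>
        = ennreal \<bar>g y * g (1 + y)\<bar> * indicator pos_orthant y"
      by (auto simp: zero_extension_def indicator_def abs_mult ennreal_mult add.commute)
  qed
  with assms show ?thesis by (simp add: generalized_Hermite_kernel_def)
qed

text \<open>Substituting r y for y gives the Jacobian r^k, and homogeneity gives r^alpha from each
  of the two factors.\<close>

lemma kernel_correlation_scale:
  fixes g :: "real ^ 'k::finite \<Rightarrow> real"
  assumes g: "generalized_Hermite_kernel \<alpha> g" and r: "r > 0"
  shows "kernel_correlation g r = ennreal (r powr (2 * \<alpha> + real CARD('k))) * kernel_correlation g 1"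
proof -
  let ?G = "zero_extension g"
  have G [measurable]: "?G \<in> borel_measurable lebesgue"
    by (rule zero_extension_measurable [OF g])
  have meas [measurable]: "(\<lambda>y. ?G (y + q *\<^sub>R 1)) \<in> borel_measurable lebesgue" for q
    using measurable_compose [OF lebesgue_scaleR_affine_measurable [of 1 "q *\<^sub>R 1"] G]
    by (simp add: add.commute)
  have "kernel_correlation g r = ennreal (\<bar>r\<bar> ^ DIM(real ^ 'k)) *
      (\<integral>\<^sup>+y. ennreal \<bar>?G (0 + r *\<^sub>R y)\<bar> * ennreal \<bar>?G ((0 + r *\<^sub>R y) + r *\<^sub>R 1)\<bar> \<partial>lebesgue)"
    unfolding kernel_correlation_def using r
    by (intro nn_integral_lebesgue_scaleR_affine) auto
  also have "(\<integral>\<^sup>+y. ennreal \<bar>?G (0 + r *\<^sub>R y)\<bar> * ennreal \<bar>?G ((0 + r *\<^sub>R y) + r *\<^sub>R 1)\<bar> \<partial>lebesgue)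
      = (\<integral>\<^sup>+y. ennreal (r powr (2 * \<alpha>)) * (ennreal \<bar>?G y\<bar> * ennreal \<bar>?G (y + 1 *\<^sub>R 1)\<bar>) \<partial>lebesgue)"
  proof (intro nn_integral_cong)
    fix y :: "real ^ 'k"
    have "?G (r *\<^sub>R y + r *\<^sub>R 1) = r powr \<alpha> * ?G (y + 1)"
      using zero_extension_scale [OF g r, of "y + 1"] by (simp add: scaleR_add_right)
    moreover have "r powr (2 * \<alpha>) = r powr \<alpha> * r powr \<alpha>"
      by (simp add: powr_add [symmetric])
    ultimately show "ennreal \<bar>?G (0 + r *\<^sub>R y)\<bar> * ennreal \<bar>?G ((0 + r *\<^sub>R y) + r *\<^sub>R 1)\<bar>
        = ennreal (r powr (2 * \<alpha>)) * (ennreal \<bar>?G y\<bar> * ennreal \<bar>?G (y + 1 *\<^sub>R 1)\<bar>)"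
      by (simp add: zero_extension_scale [OF g r] abs_mult ennreal_mult [symmetric] mult_ac)
  qed
  also have "\<dots> = ennreal (r powr (2 * \<alpha>)) * kernel_correlation g 1"
    unfolding kernel_correlation_def by (intro nn_integral_cmult) measurable
  also have "ennreal (\<bar>r\<bar> ^ DIM(real ^ 'k)) * \<dots> = ennreal (r powr (2 * \<alpha> + real CARD('k))) * kernel_correlation g 1"
    using r by (simp add: powr_add powr_realpow ennreal_mult mult_ac)
  finally show ?thesis .
qed

lemma nn_integral_abs_powr_finite:
  assumes "\<beta> > -1" "t \<ge> 0"
  shows "(\<integral>\<^sup>+u. indicator {-t..t} u * ennreal (\<bar>u\<bar> powr \<beta>) \<partial>lborel) < \<infinity>"
proof -
  define P where "P u = ennreal (u powr \<beta>) * indicator {0..t} u" for u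
  have [measurable]: "P \<in> borel_measurable borel"
    unfolding P_def by measurable
  have P: "(\<integral>\<^sup>+u. P u \<partial>lborel) < \<infinity>"
    unfolding P_def using nn_integral_has_integral_lebesgue' [OF _ has_integral_powr_from_0 [OF assms]]
    by simp
  have "(\<integral>\<^sup>+u. indicator {-t..t} u * ennreal (\<bar>u\<bar> powr \<beta>) \<partial>lborel) \<le> (\<integral>\<^sup>+u. P u + P (0 + (-1) * u) \<partial>lborel)"
    by (intro nn_integral_mono) (auto simp: P_def indicator_def)
  also have "\<dots> = (\<integral>\<^sup>+u. P u \<partial>lborel) + (\<integral>\<^sup>+u. P u \<partial>lborel)"
    using nn_integral_real_affine [of P "-1" 0] by (subst nn_integral_add) auto
  also have "\<dots> < \<infinity>" using P by simp
  finally show ?thesis .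
qed

text \<open>Fubini's theorem is applied to a Borel version \<open>G\<close> of the kernel, because Lebesgue measurable
  functions are not measurable with respect to product \<open>\<sigma>\<close>-algebras.\<close>

lemma translates_correlation:
  fixes g G :: "real ^ 'k::finite \<Rightarrow> real"
  assumes g: "generalized_Hermite_kernel \<alpha> g"
    and G [measurable]: "G \<in> borel_measurable borel" and eq: "AE y in lebesgue. zero_extension g y = G y"
    and "s \<noteq> s'"
  shows "(\<integral>\<^sup>+x. ennreal \<bar>G (s *\<^sub>R 1 - x)\<bar> * ennreal \<bar>G (s' *\<^sub>R 1 - x)\<bar> \<partial>lborel)
    = ennreal (\<bar>s' - s\<bar> powr (2 * \<alpha> + real CARD('k))) * kernel_correlation g 1"
proof -
  have less: "(\<integral>\<^sup>+x. ennreal \<bar>G (s *\<^sub>R 1 - x)\<bar> * ennreal \<bar>G (s' *\<^sub>R 1 - x)\<bar> \<partial>lborel)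
    = ennreal (\<bar>s' - s\<bar> powr (2 * \<alpha> + real CARD('k))) * kernel_correlation g 1" if "s < s'" for s s'
  proof -
    have GL [measurable]: "(\<lambda>x. G (v + c *\<^sub>R x)) \<in> borel_measurable lebesgue" for v c
      by (intro measurable_completion) simp
    have "kernel_correlation g (s' - s) = (\<integral>\<^sup>+y. ennreal \<bar>G y\<bar> * ennreal \<bar>G (y + (s' - s) *\<^sub>R 1)\<bar> \<partial>lebesgue)"
      unfolding kernel_correlation_def
      using eq AE_lebesgue_scaleR_affine [of 1, OF _ eq, of "(s' - s) *\<^sub>R 1"]
      by (intro nn_integral_cong_AE) (auto simp: add.commute)
    \<comment> \<open>The substitution y = s 1 - x; the shift by s' - s then produces the second
      translate.\<close>
    also have "\<dots> = (\<integral>\<^sup>+x. ennreal \<bar>G (s *\<^sub>R 1 + (-1) *\<^sub>R x)\<bar>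
        * ennreal \<bar>G (s *\<^sub>R 1 + (-1) *\<^sub>R x + (s' - s) *\<^sub>R 1)\<bar> \<partial>lebesgue)"
    proof -
      have "(\<lambda>y. ennreal \<bar>G y\<bar> * ennreal \<bar>G (y + (s' - s) *\<^sub>R 1)\<bar>) \<in> borel_measurable lebesgue"
        by (intro measurable_completion) simp
      from nn_integral_lebesgue_scaleR_affine [OF _ this, of "-1" "s *\<^sub>R 1"] show ?thesis
        by simp
    qed
    also have "\<dots> = (\<integral>\<^sup>+x. ennreal \<bar>G (s *\<^sub>R 1 - x)\<bar> * ennreal \<bar>G (s' *\<^sub>R 1 - x)\<bar> \<partial>lborel)"
      unfolding nn_integral_completion by (simp add: scaleR_diff_left algebra_simps)
    finally show ?thesis
      using kernel_correlation_scale [OF g, of "s' - s"] that by simp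
  qed
  show ?thesis
  \<comment> \<open>The correlation is symmetric in \<open>s\<close> and \<open>s'\<close>, whereas
    scaling requires a positive shift.\<close>
  proof (cases "s < s'")
    case False
    with \<open>s \<noteq> s'\<close> have "s' < s" by simp
    from less [OF this] show ?thesis by (simp add: mult.commute abs_minus_commute)
  qed (rule less)
qed

proposition translates_square_integral_finite:
  fixes g G :: "real ^ 'k::finite \<Rightarrow> real"
  assumes g: "generalized_Hermite_kernel \<alpha> g"
    and G [measurable]: "G \<in> borel_measurable borel" and eq: "AE y in lebesgue. zero_extension g y = G y"
    and t: "t \<ge> 0"
  shows "(\<integral>\<^sup>+x. (\<integral>\<^sup>+s. indicator {0..t} s * ennreal \<bar>G (s *\<^sub>R 1 - x)\<bar> \<partial>lborel)\<^sup>2 \<partial>lborel) < \<infinity>"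
proof -
  define \<beta> where "\<beta> = 2 * \<alpha> + real CARD('k)"
  have \<beta>: "\<beta> > -1"
    using g by (auto simp: \<beta>_def generalized_Hermite_kernel_def field_simps)
  define u where "u s x = indicator {0..t} s * ennreal \<bar>G (s *\<^sub>R 1 - x)\<bar>" for s x
  have u [measurable]: "(\<lambda>(s, x). u s x) \<in> borel_measurable (borel \<Otimes>\<^sub>M borel)"
    unfolding u_def by measurable
  define C where "C = (\<integral>\<^sup>+v. indicator {-t..t} v * ennreal (\<bar>v\<bar> powr \<beta>) \<partial>lborel)"
  have C: "C < \<infinity>" unfolding C_def by (rule nn_integral_abs_powr_finite [OF \<beta> t])
  have "(\<integral>\<^sup>+x. (\<integral>\<^sup>+s. u s x \<partial>lborel)\<^sup>2 \<partial>lborel) = (\<integral>\<^sup>+x. (\<integral>\<^sup>+s. (\<integral>\<^sup>+s'. u s x * u s' x \<partial>lborel) \<partial>lborel) \<partial>lborel)"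
    by (simp add: power2_eq_square nn_integral_cmult nn_integral_multc)
  also have "\<dots> = (\<integral>\<^sup>+s. (\<integral>\<^sup>+x. (\<integral>\<^sup>+s'. u s x * u s' x \<partial>lborel) \<partial>lborel) \<partial>lborel)"
    by (rule lborel_pair.Fubini') measurable
  also have "\<dots> = (\<integral>\<^sup>+s. (\<integral>\<^sup>+s'. (\<integral>\<^sup>+x. u s x * u s' x \<partial>lborel) \<partial>lborel) \<partial>lborel)"
    by (intro nn_integral_cong lborel_pair.Fubini') measurable
  also have "\<dots> \<le> (\<integral>\<^sup>+s. indicator {0..t} s * (C * kernel_correlation g 1) \<partial>lborel)"
  proof (rule nn_integral_mono)
    fix s :: real
    have "(\<integral>\<^sup>+s'. (\<integral>\<^sup>+x. u s x * u s' x \<partial>lborel) \<partial>lborel)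
        \<le> (\<integral>\<^sup>+s'. indicator {0..t} s * (indicator {-t..t} (s' - s) * ennreal (\<bar>s' - s\<bar> powr \<beta>)) * kernel_correlation g 1 \<partial>lborel)"
    proof (rule nn_integral_mono_AE)
      \<comment> \<open>At s' = s the inner integral is the squared norm of a translate, to which
        the correlation formula does not apply; a single point does not affect the integral.\<close>
      have "AE s' in lborel. s' \<noteq> s"
        by (rule AE_lborel_singleton)
      then show "AE s' in lborel. (\<integral>\<^sup>+x. u s x * u s' x \<partial>lborel)
          \<le> indicator {0..t} s * (indicator {-t..t} (s' - s) * ennreal (\<bar>s' - s\<bar> powr \<beta>)) * kernel_correlation g 1"
      proof eventually_elim
        fix s' assume "s' \<noteq> s"
        then have K: "(\<integral>\<^sup>+x. ennreal \<bar>G (s *\<^sub>R 1 - x)\<bar> * ennreal \<bar>G (s' *\<^sub>R 1 - x)\<bar> \<partial>lborel)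
            = ennreal (\<bar>s' - s\<bar> powr \<beta>) * kernel_correlation g 1"
          unfolding \<beta>_def by (intro translates_correlation [OF g G eq]) auto
        have "(\<integral>\<^sup>+x. u s x * u s' x \<partial>lborel) = (\<integral>\<^sup>+x. indicator {0..t} s * indicator {0..t} s' *
            (ennreal \<bar>G (s *\<^sub>R 1 - x)\<bar> * ennreal \<bar>G (s' *\<^sub>R 1 - x)\<bar>) \<partial>lborel)"
          unfolding u_def by (simp add: mult_ac)
        also have "\<dots> = indicator {0..t} s * indicator {0..t} s' * (ennreal (\<bar>s' - s\<bar> powr \<beta>) * kernel_correlation g 1)"
          unfolding K [symmetric] by (rule nn_integral_cmult) measurable
        \<comment> \<open>Relaxing \<open>s' \<in> {0..t}\<close> to
          \<open>s' - s \<in> {-t..t}\<close> makes the integral over s' a constant \<open>C\<close>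
          independent of \<open>s\<close>.\<close>
        also have "\<dots> \<le> indicator {0..t} s * (indicator {-t..t} (s' - s) * ennreal (\<bar>s' - s\<bar> powr \<beta>)) * kernel_correlation g 1"
          by (auto simp: indicator_def)
        finally show "(\<integral>\<^sup>+x. u s x * u s' x \<partial>lborel)
          \<le> indicator {0..t} s * (indicator {-t..t} (s' - s) * ennreal (\<bar>s' - s\<bar> powr \<beta>)) * kernel_correlation g 1" .
      qed
    qed
    also have "\<dots> = indicator {0..t} s * (\<integral>\<^sup>+s'. indicator {-t..t} (s' - s) * ennreal (\<bar>s' - s\<bar> powr \<beta>) \<partial>lborel) * kernel_correlation g 1"
      by (subst nn_integral_multc, measurable, subst nn_integral_cmult) auto
    also have "(\<integral>\<^sup>+s'. indicator {-t..t} (s' - s) * ennreal (\<bar>s' - s\<bar> powr \<beta>) \<partial>lborel) = C"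
      unfolding C_def
      using nn_integral_real_affine [of "\<lambda>s'. indicator {-t..t} (s' - s) * ennreal (\<bar>s' - s\<bar> powr \<beta>)" 1 s]
      by simp
    finally show "(\<integral>\<^sup>+s'. (\<integral>\<^sup>+x. u s x * u s' x \<partial>lborel) \<partial>lborel) \<le> indicator {0..t} s * (C * kernel_correlation g 1)"
      by (simp add: mult.assoc)
  qed
  also have "\<dots> = ennreal t * (C * kernel_correlation g 1)"
    using t by (subst nn_integral_multc) auto
  also have "\<dots> < \<infinity>"
    using C kernel_correlation_1_finite [OF g] by (auto simp: ennreal_mult_less_top)
  finally show ?thesis by (simp add: u_def)
qed

text \<open>For fixed \<open>s\<close> the exceptional \<open>x\<close> lie in a reflected translate
  of a null set. Fubini exchanges the two quantifiers once that null set has been enlarged to a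
  Borel one, which makes the exceptional set measurable for the product.\<close>

lemma AE_translates_eq:
  fixes G G' :: "real ^ 'k::finite \<Rightarrow> real"
  assumes "AE y in lebesgue. G y = G' y"
  shows "AE x in lebesgue. AE s in lebesgue. G (s *\<^sub>R 1 - x) = G' (s *\<^sub>R 1 - x)"
proof -
  have "AE y in lborel. G y = G' y"
    using assms by (simp add: AE_completion_iff)
  then obtain N where N: "N \<in> null_sets lborel" "{y \<in> space lborel. G y \<noteq> G' y} \<subseteq> N"
    by (auto simp: eventually_ae_filter)
  then have [measurable]: "N \<in> sets borel" by auto
  have meas: "{p \<in> space (lborel \<Otimes>\<^sub>M lborel). snd p *\<^sub>R 1 - fst p \<notin> N}
      \<in> sets (lborel \<Otimes>\<^sub>M (lborel :: real measure))"
  proof -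
    have "(\<lambda>p. snd p *\<^sub>R 1 - fst p) -` (- N) \<inter> space (lborel \<Otimes>\<^sub>M (lborel :: real measure))
        \<in> sets (lborel \<Otimes>\<^sub>M lborel)"
      by (rule measurable_sets [where A = borel]) auto
    then show ?thesis by (simp add: vimage_def Int_def conj_commute)
  qed
  have "AE x in lborel. s *\<^sub>R 1 - x \<notin> N" for s :: real
  proof -
    have "AE y in lebesgue. y \<notin> N"
      using N(1) by (auto simp: AE_completion_iff intro: AE_not_in)
    from AE_lebesgue_scaleR_affine [OF _ this, of "-1" "s *\<^sub>R 1"] show ?thesis
      by (simp add: AE_completion_iff)
  qed
  then have "AE x in lborel. AE s in lborel. s *\<^sub>R 1 - x \<notin> N"
    by (subst lborel_pair.AE_commute [OF meas]) simp
  then show ?thesis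
    unfolding AE_completion_iff
  proof eventually_elim
    fix x assume "AE s in lborel. s *\<^sub>R 1 - x \<notin> N"
    then show "AE s in lborel. G (s *\<^sub>R 1 - x) = G' (s *\<^sub>R 1 - x)"
      by eventually_elim (use N(2) in auto)
  qed
qed

theorem h_fun_well_defined:
  fixes g :: "real ^ 'k::finite \<Rightarrow> real"
  assumes g: "generalized_Hermite_kernel \<alpha> g" and t: "t \<ge> 0"
  shows "AE x in lebesgue. set_integrable lebesgue {0..t} (h_integrand g x)"
    and "square_integrable lebesgue (h_fun g t)"
proof -
  obtain G where G [measurable]: "G \<in> borel_measurable borel" and "AE y in lborel. zero_extension g y = G y"
    using completion_ex_borel_measurable_real [OF zero_extension_measurable [OF g]] by auto
  then have eq: "AE y in lebesgue. zero_extension g y = G y"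
    by (simp add: AE_completion_iff)
  \<comment> \<open>The majorant: a finite \<open>A x\<close> makes the time integral converge
    absolutely at almost every such \<open>x\<close>, and the L2 norm of \<open>A\<close> bounds
    that of \<open>h_fun g t\<close>.\<close>
  define A where "A x = (\<integral>\<^sup>+s. indicator {0..t} s * ennreal \<bar>G (s *\<^sub>R 1 - x)\<bar> \<partial>lborel)" for x
  have [measurable]: "A \<in> borel_measurable borel"
    unfolding A_def by measurable
  have A2: "(\<integral>\<^sup>+x. (A x)\<^sup>2 \<partial>lborel) < \<infinity>"
    unfolding A_def by (rule translates_square_integral_finite [OF g G eq t])
  then have "AE x in lborel. (A x)\<^sup>2 \<noteq> \<infinity>"
    by (intro nn_integral_PInf_AE) auto
  then have A_fin: "AE x in lebesgue. A x < \<infinity>"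
    unfolding AE_completion_iff
    by eventually_elim (auto simp: power2_eq_square ennreal_mult_eq_top_iff top.not_eq_extremum)
  define F where "F x s = indicator {0..t} s *\<^sub>R G (s *\<^sub>R 1 - x)" for x s
  have F [measurable]: "(\<lambda>(x, s). F x s) \<in> borel_measurable (borel \<Otimes>\<^sub>M borel)"
    unfolding F_def by measurable
  have F_int: "integrable lebesgue (F x)" if "A x < \<infinity>" for x
  proof -
    have "integrable lborel (F x)"
    proof (rule integrableI_bounded)
      have "(\<integral>\<^sup>+s. ennreal (norm (F x s)) \<partial>lborel) = A x"
        unfolding A_def by (intro nn_integral_cong) (auto simp: F_def indicator_def)
      with that show "(\<integral>\<^sup>+s. ennreal (norm (F x s)) \<partial>lborel) < \<infinity>" by simp
    qed measurable
    then show ?thesis by (subst integrable_completion) auto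
  qed
  have F_eq: "AE x in lebesgue. AE s in lebesgue. F x s = indicator {0..t} s *\<^sub>R h_integrand g x s"
    using AE_translates_eq [OF eq]
  proof eventually_elim
    fix x assume "AE s in lebesgue. zero_extension g (s *\<^sub>R 1 - x) = G (s *\<^sub>R 1 - x)"
    then show "AE s in lebesgue. F x s = indicator {0..t} s *\<^sub>R h_integrand g x s"
      by eventually_elim (simp add: F_def h_integrand_eq_zero_extension)
  qed
  have int: "integrable lebesgue (\<lambda>s. indicator {0..t} s *\<^sub>R h_integrand g x s)"
      "(LINT s|lebesgue. F x s) = h_fun g t x"
    if "A x < \<infinity>" "AE s in lebesgue. F x s = indicator {0..t} s *\<^sub>R h_integrand g x s" for x
  proof -
    have Fx: "F x \<in> borel_measurable lebesgue"
      using F_int [OF that(1)] by (rule borel_measurable_integrable)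
    then have h: "(\<lambda>s. indicator {0..t} s *\<^sub>R h_integrand g x s) \<in> borel_measurable lebesgue"
      by (rule borel_measurable_AE [OF _ that(2)])
    show "integrable lebesgue (\<lambda>s. indicator {0..t} s *\<^sub>R h_integrand g x s)"
      by (rule integrable_cong_AE [THEN iffD1, OF Fx h that(2) F_int [OF that(1)]])
    show "(LINT s|lebesgue. F x s) = h_fun g t x"
      unfolding h_fun_def set_lebesgue_integral_def
      by (rule integral_cong_AE [OF Fx h that(2)])
  qed
  show "AE x in lebesgue. set_integrable lebesgue {0..t} (h_integrand g x)"
    unfolding set_integrable_def using A_fin F_eq by eventually_elim (rule int(1))
  \<comment> \<open>A Borel function that agrees almost everywhere with \<open>h_fun g t\<close>;
    the latter is then measurable by completeness of Lebesgue measure.\<close>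
  define h where "h x = (LINT s|lborel. F x s)" for x
  have [measurable]: "h \<in> borel_measurable borel"
    unfolding h_def by measurable
  have h_eq: "AE x in lebesgue. h x = h_fun g t x"
    using A_fin F_eq
    by eventually_elim (simp add: h_def int(2) [symmetric] integral_completion)
  have "h_fun g t \<in> borel_measurable lebesgue"
    by (rule borel_measurable_AE [OF _ h_eq]) (simp add: measurable_completion)
  moreover have "(\<integral>\<^sup>+x. ennreal ((h_fun g t x)\<^sup>2) \<partial>lebesgue) = (\<integral>\<^sup>+x. ennreal ((h x)\<^sup>2) \<partial>lebesgue)"
    using h_eq by (intro nn_integral_cong_AE) auto
  moreover have "(\<integral>\<^sup>+x. ennreal ((h x)\<^sup>2) \<partial>lebesgue) \<le> (\<integral>\<^sup>+x. (A x)\<^sup>2 \<partial>lborel)"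
    unfolding nn_integral_completion
  proof (rule nn_integral_mono)
    fix x
    have "ennreal \<bar>h x\<bar> \<le> (\<integral>\<^sup>+s. ennreal (norm (F x s)) \<partial>lborel)"
      unfolding h_def using integral_norm_bound_ennreal [of lborel "F x"]
      \<comment> \<open>Where \<open>F x\<close> is not integrable, the Bochner integral is 0 by
        convention, so the bound holds there as well.\<close>
      by (cases "integrable lborel (F x)") (auto simp: not_integrable_integral_eq)
    also have "\<dots> = A x"
      unfolding A_def by (intro nn_integral_cong) (auto simp: F_def indicator_def)
    finally have "(ennreal \<bar>h x\<bar>)\<^sup>2 \<le> (A x)\<^sup>2"
      by (rule power_mono) simp
    then show "ennreal ((h x)\<^sup>2) \<le> (A x)\<^sup>2"
      by (simp add: ennreal_power)
  qed
  ultimately show "square_integrable lebesgue (h_fun g t)"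
    using A2 by (auto simp: square_integrable_iff_nn_integral)
qed

section \<open>Scaling and translation of the time integrals\<close>

lemma lebesgue_integral_real_affine_lebesgue:
  fixes f :: "real \<Rightarrow> real"
  assumes c: "c \<noteq> 0" and f: "f \<in> borel_measurable lebesgue"
  shows "(LINT x|lebesgue. f x) = \<bar>c\<bar> * (LINT x|lebesgue. f (t + c * x))"
proof -
  have T [measurable]: "(\<lambda>x. t + c * x) \<in> lebesgue \<rightarrow>\<^sub>M lebesgue"
    using lebesgue_scaleR_affine_measurable [OF c, of t] by simp
  have "(LINT x|lebesgue. f x)
      = (LINT x|density (distr lebesgue lebesgue (\<lambda>x. t + c * x)) (\<lambda>_. ennreal \<bar>c\<bar>). f x)"
    using lebesgue_real_affine [OF c, of t] by simp
  also have "\<dots> = (LINT x|distr lebesgue lebesgue (\<lambda>x. t + c * x). \<bar>c\<bar> *\<^sub>R f x)"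
    using f by (intro integral_density) auto
  also have "\<dots> = \<bar>c\<bar> * (LINT x|lebesgue. f (t + c * x))"
    using f by (subst integral_distr [OF T]) auto
  finally show ?thesis .
qed

text \<open>The substitution in \<open>s\<close> contributes one factor \<open>a\<close>, the
  homogeneity of the kernel \<open>a powr \<alpha>\<close>. Integrability at \<open>x\<close>
  supplies the measurability of the time integrand, which is known for almost every
  \<open>x\<close>.\<close>

lemma h_fun_scale:
  fixes x :: "real ^ 'k::finite"
  assumes g: "generalized_Hermite_kernel \<alpha> g" and a: "a > 0"
    and int: "set_integrable lebesgue {0..t} (h_integrand g x)"
  shows "h_fun g (a * t) (a *\<^sub>R x) = a powr (1 + \<alpha>) * h_fun g t x"
proof -
  define F where "F s = indicator {0..t} s *\<^sub>R h_integrand g x s" for s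
  have F: "F \<in> borel_measurable lebesgue"
    using int unfolding set_integrable_def F_def by (rule borel_measurable_integrable)
  have "indicator {0..a * t} s *\<^sub>R h_integrand g (a *\<^sub>R x) s = a powr \<alpha> * F (0 + (1 / a) * s)" for s
  proof -
    have "s \<in> {0..a * t} \<longleftrightarrow> s / a \<in> {0..t}"
      using a by (simp add: field_simps)
    then show ?thesis
      using h_integrand_scale [OF g a, of x "s / a"] a by (simp add: F_def indicator_def)
  qed
  then have "h_fun g (a * t) (a *\<^sub>R x) = a powr \<alpha> * (LINT s|lebesgue. F (0 + (1 / a) * s))"
    unfolding h_fun_def set_lebesgue_integral_def by simp
  also have "(LINT s|lebesgue. F (0 + (1 / a) * s)) = a * (LINT s|lebesgue. F s)"
    using lebesgue_integral_real_affine_lebesgue [OF _ F, of "1 / a" 0] a by simp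
  also have "(LINT s|lebesgue. F s) = h_fun g t x"
    by (simp add: h_fun_def set_lebesgue_integral_def F_def)
  finally show ?thesis using a by (simp add: powr_add)
qed

lemma h_fun_diff:
  assumes uv: "0 \<le> u" "u \<le> v" and int: "set_integrable lebesgue {0..v} (h_integrand g x)"
  shows "h_fun g v x - h_fun g u x = (LINT s:{u<..v}|lebesgue. h_integrand g x s)"
    and "set_integrable lebesgue {u<..v} (h_integrand g x)"
proof -
  have sub: "set_integrable lebesgue {0..u} (h_integrand g x)" "set_integrable lebesgue {u<..v} (h_integrand g x)"
    using uv by (auto intro: set_integrable_subset [OF int])
  have "{0..v} = {0..u} \<union> {u<..v}" "{0..u} \<inter> {u<..v} = {}" using uv by auto
  then show "h_fun g v x - h_fun g u x = (LINT s:{u<..v}|lebesgue. h_integrand g x s)"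
    unfolding h_fun_def using set_integral_Un [OF _ sub] by auto
  show "set_integrable lebesgue {u<..v} (h_integrand g x)" by (rule sub(2))
qed

text \<open>A single \<open>h_fun g (v + b)\<close> need not be a translate of
  \<open>h_fun g v\<close>, because time integration starts at 0. In the increment the initial
  stretch cancels, and shifting \<open>s\<close> by \<open>b\<close> moves the time window and the
  point together.\<close>

lemma h_fun_increment_translate:
  fixes x :: "real ^ 'k::finite"
  assumes uv: "0 \<le> u" "u \<le> v" "0 \<le> b"
    and int: "set_integrable lebesgue {0..v} (h_integrand g x)"
      "set_integrable lebesgue {0..v + b} (h_integrand g (b *\<^sub>R 1 + x))"
  shows "h_fun g (v + b) (b *\<^sub>R 1 + x) - h_fun g (u + b) (b *\<^sub>R 1 + x) = h_fun g v x - h_fun g u x"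
proof -
  have "h_fun g (v + b) (b *\<^sub>R 1 + x) - h_fun g (u + b) (b *\<^sub>R 1 + x)
      = (LINT s:{u + b<..v + b}|lebesgue. h_integrand g (b *\<^sub>R 1 + x) s)"
    using uv by (intro h_fun_diff(1) int) auto
  also have "\<dots> = (LINT s:{u<..v}|lebesgue. h_integrand g x s)"
  proof -
    have "set_integrable lebesgue {u + b<..v + b} (h_integrand g (b *\<^sub>R 1 + x))"
      using uv by (intro h_fun_diff(2) int) auto
    then have "(\<lambda>s. indicator {u + b<..v + b} s *\<^sub>R h_integrand g (b *\<^sub>R 1 + x) s) \<in> borel_measurable lebesgue"
      unfolding set_integrable_def by (rule borel_measurable_integrable)
    from lebesgue_integral_real_affine_lebesgue [OF _ this, of 1 b] show ?thesis
      unfolding set_lebesgue_integral_def by (simp add: h_integrand_translate indicator_def)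
  qed
  also have "\<dots> = h_fun g v x - h_fun g u x"
    using uv by (intro h_fun_diff(1) [symmetric] int) auto
  finally show ?thesis .
qed

section \<open>Self-similarity and stationarity of the increments\<close>

theorem theorem3p5:
  fixes g :: "real ^ 'k::finite \<Rightarrow> real"
    and \<alpha> H :: real
    and M :: "'a measure"
    and W :: "real \<Rightarrow> 'a \<Rightarrow> real"
  assumes "generalized_Hermite_kernel \<alpha> g"
    and "brownian_motion M W"
    and "H = \<alpha> + real CARD('k) / 2 + 1"
  shows "(\<forall>t>0. (AE x in lebesgue. set_integrable lebesgue {0..t} (h_integrand g x)) \<and>
                square_integrable lebesgue (h_fun g t)) \<and>
         sssi M H (\<lambda>t. wiener_ito_integral M W (h_fun g t)) \<and>
         H \<in> {1/2<..<1}"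
proof (intro conjI allI impI)
  note g = assms(1) and W = assms(2) and H = assms(3)
  show "AE x in lebesgue. set_integrable lebesgue {0..t} (h_integrand g x)"
    and "square_integrable lebesgue (h_fun g t)" if "t > 0" for t
    using h_fun_well_defined [OF g, of t] that by auto
  show "H \<in> {1/2<..<1}"
    using g H by (auto simp: generalized_Hermite_kernel_def field_simps)
  define Z where "Z t = wiener_ito_integral M W (h_fun g t)" for t
  \<comment> \<open>Time 0 belongs to the time set of the process, hence \<open>t \<ge> 0\<close>
    here.\<close>
  have Z: "has_wiener_ito_integral M W (h_fun g t) (Z t)" if "t \<ge> 0" for t
    unfolding Z_def
    by (intro has_wiener_ito_integral_wiener_ito_integral [OF W] h_fun_well_defined [OF g that])
  have "self_similar M H Z"
    unfolding self_similar_def same_fdd_def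
  proof (intro allI impI, elim conjE)
    fix a :: real and J :: "real set"
    assume a: "0 < a" and J: "finite J" "J \<subseteq> {0..}"
    \<comment> \<open>The first factor comes from the kernels, the second from the scaling of the
      Brownian increments; together they give the exponent \<open>H\<close>.\<close>
    have "a powr (1 + \<alpha>) * sqrt a ^ CARD('k) = a powr H"
      using a unfolding H by (simp add: powr_half_sqrt [symmetric] powr_power powr_add [symmetric] algebra_simps)
    moreover have "distr M (Pi\<^sub>M J (\<lambda>_. borel)) (\<lambda>\<omega>. \<lambda>t\<in>J. Z (a * t) \<omega>)
        = distr M (Pi\<^sub>M J (\<lambda>_. borel)) (\<lambda>\<omega>. \<lambda>t\<in>J. a powr (1 + \<alpha>) * sqrt a ^ CARD('k) * Z t \<omega>)"
    proof (rule wiener_ito_integrals_affine_law [OF W J(1) a])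
      fix t assume "t \<in> J"
      then have t: "0 \<le> t" using J by auto
      then show "has_wiener_ito_integral M W (h_fun g t) (Z t)"
        "has_wiener_ito_integral M W (h_fun g (a * t)) (Z (a * t))"
        using a by (auto intro: Z)
      show "AE x in lebesgue. h_fun g (a * t) (0 *\<^sub>R 1 + a *\<^sub>R x) = a powr (1 + \<alpha>) * h_fun g t x"
        using h_fun_well_defined(1) [OF g t] by eventually_elim (simp add: h_fun_scale [OF g a])
    qed
    ultimately show "distr M (Pi\<^sub>M J (\<lambda>_. borel)) (\<lambda>\<omega>. \<lambda>t\<in>J. Z (a * t) \<omega>)
        = distr M (Pi\<^sub>M J (\<lambda>_. borel)) (\<lambda>\<omega>. \<lambda>t\<in>J. a powr H * Z t \<omega>)"
      by simp
  qed
  moreover have "stationary_increments M Z"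
    unfolding stationary_increments_def stationary_def same_fdd_def
  proof (intro allI impI, elim conjE)
    fix h s :: real and J :: "real set"
    assume h: "0 \<le> h" and s: "0 \<le> s" and J: "finite J" "J \<subseteq> {0..}"
    \<comment> \<open>A pure translation by \<open>s\<close>: scale 1 and factor 1, applied to the
      kernels of the increments.\<close>
    have "distr M (Pi\<^sub>M J (\<lambda>_. borel)) (\<lambda>\<omega>. \<lambda>t\<in>J. Z (t + s + h) \<omega> - Z (t + s) \<omega>)
        = distr M (Pi\<^sub>M J (\<lambda>_. borel)) (\<lambda>\<omega>. \<lambda>t\<in>J. 1 * sqrt 1 ^ CARD('k) * (Z (t + h) \<omega> - Z t \<omega>))"
    proof (rule wiener_ito_integrals_affine_law [OF W J(1) zero_less_one])
      fix t assume "t \<in> J"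
      then have t: "0 \<le> t" using J by auto
      show "has_wiener_ito_integral M W (\<lambda>x. h_fun g (t + h) x - h_fun g t x) (\<lambda>\<omega>. Z (t + h) \<omega> - Z t \<omega>)"
        "has_wiener_ito_integral M W (\<lambda>x. h_fun g (t + s + h) x - h_fun g (t + s) x)
          (\<lambda>\<omega>. Z (t + s + h) \<omega> - Z (t + s) \<omega>)"
        using t h s by (auto intro!: has_wiener_ito_integral_diff [OF W] Z)
      have "AE x in lebesgue. set_integrable lebesgue {0..t + h} (h_integrand g x)"
        using t h by (intro h_fun_well_defined(1) [OF g]) auto
      \<comment> \<open>Translations preserve null sets, so integrability at the shifted point also
        holds for almost every \<open>x\<close>.\<close>
      moreover have "AE x in lebesgue. set_integrable lebesgue {0..t + h + s} (h_integrand g (s *\<^sub>R 1 + 1 *\<^sub>R x))"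
        using t h s by (intro AE_lebesgue_scaleR_affine h_fun_well_defined(1) [OF g]) auto
      ultimately show "AE x in lebesgue. h_fun g (t + s + h) (s *\<^sub>R 1 + 1 *\<^sub>R x) - h_fun g (t + s) (s *\<^sub>R 1 + 1 *\<^sub>R x)
          = 1 * (h_fun g (t + h) x - h_fun g t x)"
      proof eventually_elim
        fix x assume "set_integrable lebesgue {0..t + h} (h_integrand g x)"
          "set_integrable lebesgue {0..t + h + s} (h_integrand g (s *\<^sub>R 1 + 1 *\<^sub>R x))"
        then show "h_fun g (t + s + h) (s *\<^sub>R 1 + 1 *\<^sub>R x) - h_fun g (t + s) (s *\<^sub>R 1 + 1 *\<^sub>R x)
            = 1 * (h_fun g (t + h) x - h_fun g t x)"
          using h_fun_increment_translate [of t "t + h" s g x] t h s by (simp add: add_ac)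
      qed
    qed
    then show "distr M (Pi\<^sub>M J (\<lambda>_. borel)) (\<lambda>\<omega>. \<lambda>t\<in>J. Z (t + s + h) \<omega> - Z (t + s) \<omega>)
        = distr M (Pi\<^sub>M J (\<lambda>_. borel)) (\<lambda>\<omega>. \<lambda>t\<in>J. Z (t + h) \<omega> - Z t \<omega>)"
      by simp
  qed
  ultimately show "sssi M H (\<lambda>t. wiener_ito_integral M W (h_fun g t))"
    using Z unfolding sssi_def Z_def [symmetric, abs_def]
    by (auto simp: has_wiener_ito_integral_def)
qed

end
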